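(* Let $u_1:\mathbb{R}\to\mathbb{R}$ and $u_3:\mathbb{R}\to\mathbb{R}$ be continuous functions such that, for each $u\in\{u_1,u_3\}$, the finite limit $u(\infty):=\lim_{t\to\infty}u(t)$ exists and the Dini conditions $$\int_0^1\frac{\omega_{\mathbb{R}}(u,\eta)}{\eta}\,d\eta<\infty,\qquad \int_0^1\frac{\omega_{\mathbb{R},\infty}(u,\eta)}{\eta}\,d\eta<\infty$$ hold. Then the general solution of the (1-3)-problem for the half-plane $\Pi^+$ with data $u_1,u_3$ is expressed in the form $$\Phi(\zeta)=S_{\Pi^+}[u_1](\zeta)\,e_1+S_{\Pi^+}[u_3](\zeta)\,e_2+a_1\,ie_1+a_2\,ie_2\qquad(\zeta\in\Pi^+),$$ where $a_1,a_2$ are arbitrary real constants. (That is, for all real $a_1,a_2$ this function, extended to $\overline{\Pi^+}$ by its limiting values, is a solution, and every solution has this form.)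
   Context: Algebra: $\mathbb{B}$ is the commutative associative two-dimensional algebra over $\mathbb{C}$ with basis $\{e_1,e_2\}$, where $e_1=1$ is the unit and $e_2^2=e_1+2ie_2$ ($i$ is the complex imaginary unit). Norm: $\|z_1e_1+z_2e_2\|=\sqrt{|z_1|^2+|z_2|^2}$ for $z_1,z_2\in\mathbb{C}$. The biharmonic plane is $\mu=\{\zeta=xe_1+ye_2: x,y\in\mathbb{R}\}$; all its nonzero elements are invertible in $\mathbb{B}$. Real numbers $\xi$ are identified with $\xi e_1\in\mu$. Monogenic: for a domain $\Omega\subset\mu$, a function $\Phi:\Omega\to\mathbb{B}$ is monogenic in $\Omega$ if for every $\zeta\in\Omega$ the limit $\Phi'(\zeta)=\lim_{h\to0,\,h\in\mu}(\Phi(\zeta+h)-\Phi(\zeta))h^{-1}$ exists. Components: every $\Phi$ with values in $\mathbb{B}$ is written $\Phi(\zeta)=U_1(x,y)e_1+U_2(x,y)ie_1+U_3(x,y)e_2+U_4(x,y)ie_2$ with real-valued $U_1,\dots,U_4$, where $\zeta=xe_1+ye_2$. Half-plane: $\Pi^+=\{xe_1+ye_2: x\in\mathbb{R},\,y>0\}$, with closure $\overline{\Pi^+}=\{xe_1+ye_2: x\in\mathbb{R},\,y\ge 0\}$. (1-3)-problem for $\Pi^+$ with data $u_1,u_3$: find a continuous function $\Phi:\overline{\Pi^+}\to\mathbb{B}$ which is monogenic in $\Pi^+$, for which the limit $\lim_{\|\zeta\|\to\infty,\ \zeta\in\Pi^+}\Phi(\zeta)$ exists in $\mathbb{B}$,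 and whose components satisfy $U_1(\xi,0)=u_1(\xi)$ and $U_3(\xi,0)=u_3(\xi)$ for all $\xi\in\mathbb{R}$. Moduli of continuity: $\omega_{\mathbb{R}}(u,\varepsilon)=\sup\{|u(\tau_1)-u(\tau_2)|:\tau_1,\tau_2\in\mathbb{R},\ |\tau_1-\tau_2|\le\varepsilon\}$ and $\omega_{\mathbb{R},\infty}(u,\varepsilon)=\sup\{|u(\tau)-u(\infty)|:\tau\in\mathbb{R},\ |\tau|\ge1/\varepsilon\}$. Here $\lim_{t\to\infty}$ means the limit as $|t|\to\infty$. Biharmonic Schwartz integral for $\Pi^+$: $$S_{\Pi^+}[u](\zeta)=\frac{1}{\pi i}\int_{-\infty}^{+\infty}\frac{u(t)(1+t\zeta)}{t^2+1}(t-\zeta)^{-1}\,dt,\qquad \zeta\in\Pi^+,$$ where $t$ stands for $te_1$, $(t-\zeta)^{-1}$ is the inverse in $\mathbb{B}$, and $\int_{-\infty}^{+\infty}$ means $\lim_{N\to+\infty}\int_{-N}^{N}$. *)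

theory Defs
  imports "HOL-Analysis.Analysis"
begin

section \<open>The biharmonic algebra\<close>

text \<open>
  The pair \<open>(z1, z2)\<close> stands for \<open>z1 e1 + z2 e2\<close>. The product type is used so that the library
  norm \<open>sqrt (|z1|^2 + |z2|^2)\<close>, topology and integral are available directly.
\<close>

type_synonym biharm = "complex \<times> complex"

definition e1 :: biharm where "e1 = (1, 0)"

definition e2 :: biharm where "e2 = (0, 1)"

definition cscale :: "complex \<Rightarrow> biharm \<Rightarrow> biharm" (infixr "*\<^sub>C" 75) where
  "c *\<^sub>C a = (c * fst a, c * snd a)"

text \<open>The bilinear extension of \<open>e1 e1 = e1\<close>, \<open>e1 e2 = e2 e1 = e2\<close>, \<open>e2 e2 = e1 + 2 i e2\<close>.\<close>

definition bmult :: "biharm \<Rightarrow> biharm \<Rightarrow> biharm" (infixl "*\<^sub>B" 70) where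
  "a *\<^sub>B b = (fst a * fst b + snd a * snd b,
              fst a * snd b + snd a * fst b + 2 * \<i> * snd a * snd b)"

lemma biharm_decomp: "a = fst a *\<^sub>C e1 + snd a *\<^sub>C e2"
  by (simp add: cscale_def e1_def e2_def)

lemma norm_biharm: "norm (z1 *\<^sub>C e1 + z2 *\<^sub>C e2) = sqrt ((cmod z1)\<^sup>2 + (cmod z2)\<^sup>2)"
  by (simp add: cscale_def e1_def e2_def norm_Pair)

lemma scaleR_eq_cscale: "r *\<^sub>R a = complex_of_real r *\<^sub>C a"
  by (simp add: cscale_def prod_eq_iff scaleR_conv_of_real)

lemma bmult_e1 [simp]: "e1 *\<^sub>B a = a" "a *\<^sub>B e1 = a"
  by (simp_all add: bmult_def e1_def)

lemma e2_squared: "e2 *\<^sub>B e2 = e1 + (2 * \<i>) *\<^sub>C e2"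
  by (simp add: bmult_def cscale_def e1_def e2_def)

lemma bmult_commute: "a *\<^sub>B b = b *\<^sub>B a"
  by (simp add: bmult_def algebra_simps)

lemma bmult_assoc: "a *\<^sub>B b *\<^sub>B c = a *\<^sub>B (b *\<^sub>B c)"
  by (simp add: bmult_def algebra_simps)

lemma bmult_distrib: "a *\<^sub>B (b + c) = a *\<^sub>B b + a *\<^sub>B c" "(b + c) *\<^sub>B a = b *\<^sub>B a + c *\<^sub>B a"
  by (simp_all add: bmult_def algebra_simps)

lemma bmult_cscale: "(c *\<^sub>C a) *\<^sub>B b = c *\<^sub>C (a *\<^sub>B b)" "a *\<^sub>B (c *\<^sub>C b) = c *\<^sub>C (a *\<^sub>B b)"
  by (simp_all add: bmult_def cscale_def algebra_simps)

text \<open>The value is meaningful for invertible elements only.\<close>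

definition binv :: "biharm \<Rightarrow> biharm" where
  "binv a = (THE b. a *\<^sub>B b = e1)"

lemma binv_eqI: "a *\<^sub>B b = e1 \<Longrightarrow> binv a = b"
  unfolding binv_def
proof (rule the_equality)
  fix c assume "a *\<^sub>B b = e1" "a *\<^sub>B c = e1"
  then have "c = c *\<^sub>B (a *\<^sub>B b)" by simp
  also have "\<dots> = a *\<^sub>B c *\<^sub>B b" by (simp only: bmult_assoc[symmetric] bmult_commute[of c a])
  also have "\<dots> = b" using \<open>a *\<^sub>B c = e1\<close> by simp
  finally show "c = b" .
qed

section \<open>The biharmonic plane and monogenic functions\<close>

definition plane_pt :: "real \<Rightarrow> real \<Rightarrow> biharm" where
  "plane_pt x y = x *\<^sub>R e1 + y *\<^sub>R e2"

definition biharm_plane :: "biharm set" where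
  "biharm_plane = {plane_pt x y | x y. True}"

definition half_plane :: "biharm set" where
  "half_plane = {plane_pt x y | x y. y > 0}"

definition closed_half_plane :: "biharm set" where
  "closed_half_plane = {plane_pt x y | x y. y \<ge> 0}"

lemma binv_plane_pt:
  assumes "x \<noteq> 0 \<or> y \<noteq> 0"
  shows "binv (plane_pt x y) =
    (1 / Complex x y + \<i> * y / (Complex x y)\<^sup>2, - complex_of_real y / (Complex x y)\<^sup>2)"
proof (rule binv_eqI)
  define w where "w = Complex x y"
  have w: "w \<noteq> 0" using assms by (auto simp: w_def complex_eq_iff)
  have x: "complex_of_real x = w - \<i> * y" by (simp add: w_def complex_eq_iff)
  have p: "plane_pt x y = (complex_of_real x, complex_of_real y)"
    by (simp add: plane_pt_def e1_def e2_def scaleR_conv_of_real)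
  show "plane_pt x y *\<^sub>B (1 / Complex x y + \<i> * y / (Complex x y)\<^sup>2, - complex_of_real y / (Complex x y)\<^sup>2) = e1"
    unfolding w_def[symmetric] p x using w by (simp add: bmult_def e1_def field_simps power2_eq_square)
qed

lemma biharm_plane_invertible:
  assumes "h \<in> biharm_plane" "h \<noteq> 0"
  shows "h *\<^sub>B binv h = e1"
proof -
  obtain x y where h: "h = plane_pt x y" using assms by (auto simp: biharm_plane_def)
  with assms have nz: "x \<noteq> 0 \<or> y \<noteq> 0" by (auto simp: plane_pt_def)
  define w where "w = Complex x y"
  have w: "w \<noteq> 0" using nz by (auto simp: w_def complex_eq_iff)
  have x: "complex_of_real x = w - \<i> * y" by (simp add: w_def complex_eq_iff)
  have p: "plane_pt x y = (complex_of_real x, complex_of_real y)"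
    by (simp add: plane_pt_def e1_def e2_def scaleR_conv_of_real)
  show ?thesis
    unfolding h binv_plane_pt[OF nz] unfolding w_def[symmetric] unfolding p x
    using w by (simp add: bmult_def e1_def field_simps power2_eq_square)
qed

text \<open>
  For \<open>\<Omega>\<close> relatively open in the plane, the restriction \<open>\<zeta> + h \<in> \<Omega>\<close> does not change the limit; it
  only makes the values of the total function \<open>\<Phi>\<close> outside \<open>\<Omega>\<close> irrelevant.
\<close>

definition monogenic_on :: "(biharm \<Rightarrow> biharm) \<Rightarrow> biharm set \<Rightarrow> bool" where
  "monogenic_on \<Phi> \<Omega> \<longleftrightarrow>
     (\<forall>\<zeta>\<in>\<Omega>. \<exists>D. ((\<lambda>h. (\<Phi> (\<zeta> + h) - \<Phi> \<zeta>) *\<^sub>B binv h) \<longlongrightarrow> D)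
                    (at 0 within {h \<in> biharm_plane. \<zeta> + h \<in> \<Omega>}))"

text \<open>The real components in \<open>\<Phi> = U1 e1 + U2 i e1 + U3 e2 + U4 i e2\<close>.\<close>

definition U1 :: "(biharm \<Rightarrow> biharm) \<Rightarrow> real \<Rightarrow> real \<Rightarrow> real" where
  "U1 \<Phi> x y = Re (fst (\<Phi> (plane_pt x y)))"

definition U2 :: "(biharm \<Rightarrow> biharm) \<Rightarrow> real \<Rightarrow> real \<Rightarrow> real" where
  "U2 \<Phi> x y = Im (fst (\<Phi> (plane_pt x y)))"

definition U3 :: "(biharm \<Rightarrow> biharm) \<Rightarrow> real \<Rightarrow> real \<Rightarrow> real" where
  "U3 \<Phi> x y = Re (snd (\<Phi> (plane_pt x y)))"

definition U4 :: "(biharm \<Rightarrow> biharm) \<Rightarrow> real \<Rightarrow> real \<Rightarrow> real" where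
  "U4 \<Phi> x y = Im (snd (\<Phi> (plane_pt x y)))"

lemma component_decomp:
  "\<Phi> (plane_pt x y) = U1 \<Phi> x y *\<^sub>R e1 + U2 \<Phi> x y *\<^sub>R (\<i> *\<^sub>C e1) +
                      U3 \<Phi> x y *\<^sub>R e2 + U4 \<Phi> x y *\<^sub>R (\<i> *\<^sub>C e2)"
  by (simp add: U1_def U2_def U3_def U4_def e1_def e2_def cscale_def prod_eq_iff complex_eq_iff)

section \<open>The (1-3)-problem for the half-plane\<close>

text \<open>
  \<open>\<Phi>\<close> is a function on the closed half-plane; its values elsewhere are irrelevant.
\<close>

definition solves_13_problem :: "(real \<Rightarrow> real) \<Rightarrow> (real \<Rightarrow> real) \<Rightarrow> (biharm \<Rightarrow> biharm) \<Rightarrow> bool" where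
  "solves_13_problem u1 u3 \<Phi> \<longleftrightarrow>
     continuous_on closed_half_plane \<Phi> \<and>
     monogenic_on \<Phi> half_plane \<and>
     (\<exists>L. (\<Phi> \<longlongrightarrow> L) (inf at_infinity (principal half_plane))) \<and>
     (\<forall>\<xi>. U1 \<Phi> \<xi> 0 = u1 \<xi> \<and> U3 \<Phi> \<xi> 0 = u3 \<xi>)"

text \<open>The extension of a function on the open half-plane to its closure by limiting values.\<close>

definition extend_by_limits :: "(biharm \<Rightarrow> biharm) \<Rightarrow> biharm \<Rightarrow> biharm" where
  "extend_by_limits F \<zeta> = (if \<zeta> \<in> half_plane then F \<zeta> else Lim (at \<zeta> within half_plane) F)"

section \<open>Moduli of continuity and Dini conditions\<close>

text \<open>
  The suprema are taken in the reals. They are genuine suprema (of nonempty bounded sets) for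
  \<open>\<epsilon> > 0\<close> and \<open>u\<close> continuous with a finite limit at infinity. On the reals, \<open>at_infinity\<close> is the
  filter \<open>|t| \<rightarrow> \<infinity>\<close>.
\<close>

definition omega_R :: "(real \<Rightarrow> real) \<Rightarrow> real \<Rightarrow> real" where
  "omega_R u \<epsilon> = Sup {\<bar>u \<tau>1 - u \<tau>2\<bar> | \<tau>1 \<tau>2. \<bar>\<tau>1 - \<tau>2\<bar> \<le> \<epsilon>}"

definition omega_R_inf :: "(real \<Rightarrow> real) \<Rightarrow> real \<Rightarrow> real" where
  "omega_R_inf u \<epsilon> = Sup {\<bar>u \<tau> - Lim at_infinity u\<bar> | \<tau>. \<bar>\<tau>\<bar> \<ge> 1 / \<epsilon>}"

definition dini_conditions :: "(real \<Rightarrow> real) \<Rightarrow> bool" where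
  "dini_conditions u \<longleftrightarrow>
     (\<integral>\<^sup>+\<eta>\<in>{0<..1}. ennreal (omega_R u \<eta> / \<eta>) \<partial>lborel) < \<infinity> \<and>
     (\<integral>\<^sup>+\<eta>\<in>{0<..1}. ennreal (omega_R_inf u \<eta> / \<eta>) \<partial>lborel) < \<infinity>"

section \<open>The biharmonic Schwartz integral\<close>

definition schwartz_integrand :: "(real \<Rightarrow> real) \<Rightarrow> biharm \<Rightarrow> real \<Rightarrow> biharm" where
  "schwartz_integrand u \<zeta> t =
     (u t / (t\<^sup>2 + 1)) *\<^sub>R ((e1 + t *\<^sub>R \<zeta>) *\<^sub>B binv (t *\<^sub>R e1 - \<zeta>))"

definition schwartz_integral :: "(real \<Rightarrow> real) \<Rightarrow> biharm \<Rightarrow> biharm" where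
  "schwartz_integral u \<zeta> =
     (1 / (complex_of_real pi * \<i>)) *\<^sub>C
       Lim at_top (\<lambda>N::real. integral {- N..N} (schwartz_integrand u \<zeta>))"

lemma norm_bmult_le: "norm (a *\<^sub>B b) \<le> 5 * norm a * norm b"
proof -
  have f: "cmod (fst c) \<le> norm c" "cmod (snd c) \<le> norm c" for c :: biharm
    by (metis norm_fst_le prod.collapse, metis norm_snd_le prod.collapse)
  have m: "cmod (p * q) \<le> norm a * norm b"
    if "cmod p \<le> norm a" "cmod q \<le> norm b" for p q
    using that by (simp add: norm_mult mult_mono)
  have 1: "cmod (fst a * fst b + snd a * snd b) \<le> 2 * (norm a * norm b)"
    using norm_triangle_ineq[of "fst a * fst b" "snd a * snd b"]
      m[OF f(1) f(1)] m[OF f(2) f(2)] by linarith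
  have "cmod (2 * \<i> * snd a * snd b) = 2 * cmod (snd a * snd b)"
    by (simp add: norm_mult)
  then have 2: "cmod (fst a * snd b + snd a * fst b + 2 * \<i> * snd a * snd b) \<le> 4 * (norm a * norm b)"
    using norm_triangle_ineq[of "fst a * snd b + snd a * fst b" "2 * \<i> * snd a * snd b"]
      norm_triangle_ineq[of "fst a * snd b" "snd a * fst b"]
      m[OF f(1) f(2)] m[OF f(2) f(1)] m[OF f(2) f(2)] by linarith
  have "norm (a *\<^sub>B b) \<le> sqrt ((2 * (norm a * norm b))\<^sup>2 + (4 * (norm a * norm b))\<^sup>2)"
    unfolding bmult_def norm_Pair by (intro real_sqrt_le_mono add_mono power_mono 1 2) auto
  also have "\<dots> \<le> sqrt ((5 * (norm a * norm b))\<^sup>2)"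
    by (intro real_sqrt_le_mono) (auto simp: power2_eq_square)
  also have "\<dots> = 5 * norm a * norm b" unfolding real_sqrt_abs by simp
  finally show ?thesis .
qed

lemma binv_shift:
  fixes x y t :: real
  assumes "y > 0"
  shows "binv (t *\<^sub>R e1 - plane_pt x y) =
    (1 / Complex (t - x) (- y) - \<i> * y / (Complex (t - x) (- y))\<^sup>2, y / (Complex (t - x) (- y))\<^sup>2)"
proof -
  have "t *\<^sub>R e1 - plane_pt x y = plane_pt (t - x) (- y)"
    by (simp add: plane_pt_def algebra_simps)
  then show ?thesis using binv_plane_pt[of "t - x" "- y"] assms by simp
qed

text \<open>
  For data as in the theorem the integrals and the limit in the definition above exist, so that
  \<open>integral\<close> and \<open>Lim\<close> are never applied outside their domain.
\<close>

lemma schwartz_integrand_continuous: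
  assumes u: "continuous_on UNIV u" and \<zeta>: "\<zeta> \<in> half_plane"
  shows "continuous_on S (schwartz_integrand u \<zeta>)"
proof -
  obtain x y where z: "\<zeta> = plane_pt x y" "y > 0" using \<zeta> by (auto simp: half_plane_def)
  have w: "Complex (t - x) (- y) \<noteq> 0" for t using z(2) by (auto simp: complex_eq_iff)
  have t: "t\<^sup>2 + 1 \<noteq> 0" for t :: real by (metis add_pos_nonneg add.commute less_irrefl zero_le_power2 zero_less_one)
  have "continuous_on UNIV (schwartz_integrand u \<zeta>)"
    unfolding schwartz_integrand_def z(1) binv_shift[OF z(2)] bmult_def
    by (intro continuous_intros u) (use w t in \<open>auto simp: Complex_eq intro!: continuous_intros\<close>)
  then show ?thesis by (rule continuous_on_subset) simp
qed

lemma schwartz_integrand_bound: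
  assumes u: "continuous_on UNIV u" and lim: "(u \<longlongrightarrow> c) at_infinity" and \<zeta>: "\<zeta> \<in> half_plane"
  obtains C where "\<And>t. norm (schwartz_integrand u \<zeta> t) \<le> C / (1 + t\<^sup>2)"
proof -
  obtain x y where z: "\<zeta> = plane_pt x y" "y > 0" using \<zeta> by (auto simp: half_plane_def)
  have "eventually (\<lambda>t. dist (u t) c < 1) at_infinity" using lim by (simp add: tendstoD)
  then obtain b where b: "\<And>t. norm t \<ge> b \<Longrightarrow> dist (u t) c < 1"
    unfolding eventually_at_infinity by blast
  have "compact (u ` {- b..b})"
    by (intro compact_continuous_image continuous_on_subset[OF u]) auto
  then obtain B where B: "\<And>t. t \<in> {- b..b} \<Longrightarrow> \<bar>u t\<bar> \<le> B"
    using compact_imp_bounded bounded_iff by (metis image_eqI real_norm_def)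
  define M where "M = max B (\<bar>c\<bar> + 1)"
  have M: "\<bar>u t\<bar> \<le> M" for t
  proof (cases "norm t \<ge> b")
    case True
    from b[OF this] show ?thesis by (auto simp: M_def dist_real_def)
  next
    case False
    then have "t \<in> {- b..b}" by auto
    from B[OF this] show ?thesis by (simp add: M_def)
  qed
  define K where "K = 1 / y + 1 + \<bar>x\<bar> / y"
  define C where "C = M * (15 * K * (1 + norm \<zeta>))"
  have "norm (schwartz_integrand u \<zeta> t) \<le> C / (1 + t\<^sup>2)" for t
  proof -
    define w where "w = Complex (t - x) (- y)"
    have wy: "y \<le> cmod w" using abs_Im_le_cmod[of w] z(2) by (simp add: w_def)
    have wp: "cmod w > 0" using wy z(2) by linarith
    have "\<bar>t - x\<bar> \<le> cmod w" using abs_Re_le_cmod[of w] by (simp add: w_def)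
    moreover have "1 \<le> cmod w / y" "\<bar>x\<bar> * 1 \<le> \<bar>x\<bar> * (cmod w / y)"
      using wy z(2) by (simp, intro mult_left_mono, auto)
    ultimately have "1 + \<bar>t\<bar> \<le> cmod w / y + cmod w + \<bar>x\<bar> * (cmod w / y)" by linarith
    then have K: "1 + \<bar>t\<bar> \<le> K * cmod w" by (simp add: K_def algebra_simps)
    have q: "y / (cmod w)\<^sup>2 \<le> 1 / cmod w"
      using wy wp by (simp add: field_simps power2_eq_square)
    have "norm (binv (t *\<^sub>R e1 - \<zeta>)) \<le>
        cmod (1 / w - \<i> * y / w\<^sup>2) + cmod (y / w\<^sup>2)"
      unfolding z(1) binv_shift[OF z(2)] w_def[symmetric] norm_Pair
      by (rule sqrt_sum_squares_le_sum) auto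
    also have "\<dots> \<le> cmod (1 / w) + cmod (\<i> * y / w\<^sup>2) + cmod (y / w\<^sup>2)"
      using norm_triangle_ineq4 by (intro add_right_mono) auto
    also have "\<dots> \<le> 3 / cmod w"
      using q z(2) by (simp add: norm_divide norm_mult norm_power)
    finally have i: "norm (binv (t *\<^sub>R e1 - \<zeta>)) \<le> 3 / cmod w" .
    have "norm (e1 + t *\<^sub>R \<zeta>) \<le> 1 + \<bar>t\<bar> * norm \<zeta>"
      using norm_triangle_ineq[of e1 "t *\<^sub>R \<zeta>"] by (simp add: e1_def norm_Pair)
    also have "\<dots> \<le> (1 + \<bar>t\<bar>) * (1 + norm \<zeta>)" by (simp add: algebra_simps)
    also have "\<dots> \<le> K * cmod w * (1 + norm \<zeta>)" by (intro mult_right_mono K) auto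
    finally have n: "norm (e1 + t *\<^sub>R \<zeta>) \<le> K * cmod w * (1 + norm \<zeta>)" .
    have "norm ((e1 + t *\<^sub>R \<zeta>) *\<^sub>B binv (t *\<^sub>R e1 - \<zeta>)) \<le>
        5 * norm (e1 + t *\<^sub>R \<zeta>) * norm (binv (t *\<^sub>R e1 - \<zeta>))"
      by (rule norm_bmult_le)
    also have "\<dots> \<le> 5 * (K * cmod w * (1 + norm \<zeta>)) * (3 / cmod w)"
      using n i order_trans[OF norm_ge_zero n] by (intro mult_mono) auto
    also have "\<dots> = 15 * K * (1 + norm \<zeta>)" using wp by simp
    finally have g: "norm ((e1 + t *\<^sub>R \<zeta>) *\<^sub>B binv (t *\<^sub>R e1 - \<zeta>)) \<le> 15 * K * (1 + norm \<zeta>)" .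
    have p: "t\<^sup>2 + 1 > 0" by (simp add: add_nonneg_pos)
    have "\<bar>u t\<bar> * norm ((e1 + t *\<^sub>R \<zeta>) *\<^sub>B binv (t *\<^sub>R e1 - \<zeta>)) \<le> C"
      unfolding C_def using M[of t] g by (intro mult_mono) auto
    from divide_right_mono[OF this less_imp_le[OF p]] show ?thesis
      using p unfolding schwartz_integrand_def norm_scaleR by (simp add: add.commute)
  qed
  then show ?thesis by (rule that)
qed

lemma symmetric_integral_converges:
  fixes f :: "real \<Rightarrow> biharm"
  assumes f: "continuous_on UNIV f" and C: "\<And>t. norm (f t) \<le> C / (1 + t\<^sup>2)"
  shows "\<exists>L. ((\<lambda>N::real. integral {- N..N} f) \<longlongrightarrow> L) at_top"
proof -
  have int: "f integrable_on {a..b}" for a b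
    by (intro integrable_continuous_interval continuous_on_subset[OF f]) auto
  have at: "((\<lambda>t. C / (1 + t\<^sup>2)) has_integral C * arctan b - C * arctan a) {a..b}" if "a \<le> b" for a b
    using that
    by (intro fundamental_theorem_of_calculus)
       (auto intro!: derivative_eq_intros simp: has_real_derivative_iff_has_vector_derivative[symmetric] field_simps)
  have piece: "norm (integral {a..b} f) \<le> C * arctan b - C * arctan a" if "a \<le> b" for a b
    using integral_norm_bound_integral[OF int has_integral_integrable[OF at[OF that]] C]
      integral_unique[OF at[OF that]] by simp
  have split: "norm (integral {- M..M} f - integral {- N..N} f) \<le> 2 * (C * arctan M - C * arctan N)"
    if "0 \<le> N" "N \<le> M" for M N
  proof -
    have "integral {- M..M} f = integral {- M..- N} f + integral {- N..N} f + integral {N..M} f"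
      using that Henstock_Kurzweil_Integration.integral_combine[of "- M" N M f]
        Henstock_Kurzweil_Integration.integral_combine[of "- M" "- N" N f] int by simp
    then have "norm (integral {- M..M} f - integral {- N..N} f)
        \<le> norm (integral {- M..- N} f) + norm (integral {N..M} f)"
      using norm_triangle_ineq[of "integral {- M..- N} f" "integral {N..M} f"] by simp
    also have "\<dots> \<le> 2 * (C * arctan M - C * arctan N)"
      using piece[of "- M" "- N"] piece[of N M] that by (simp add: arctan_minus)
    finally show ?thesis .
  qed
  have A: "((\<lambda>N. C * arctan N) \<longlongrightarrow> C * (pi / 2)) at_top"
    by (intro tendsto_intros tendsto_arctan_at_top)
  have As: "(\<lambda>n. C * arctan (real n)) \<longlonglongrightarrow> C * (pi / 2)"
    by (rule filterlim_compose[OF A filterlim_real_sequentially])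
  define I where "I = (\<lambda>N::real. integral {- N..N} f)"
  have "Cauchy (\<lambda>n. I (real n))"
  proof (rule metric_CauchyI)
    fix e :: real assume e: "e > 0"
    from LIMSEQ_imp_Cauchy[OF As] e obtain k
      where k: "\<And>m n. m \<ge> k \<Longrightarrow> n \<ge> k \<Longrightarrow> dist (C * arctan (real m)) (C * arctan (real n)) < e / 2"
      unfolding Cauchy_def by (metis half_gt_zero)
    have *: "dist (I (real m)) (I (real n)) < e" if "n \<ge> k" "m \<ge> n" for m n
    proof -
      have "dist (I (real m)) (I (real n)) \<le> 2 * (C * arctan m - C * arctan n)"
        unfolding I_def dist_norm using that by (intro split) auto
      also have "\<dots> < e"
        using le_less_trans[OF abs_ge_self k[OF order_trans[OF that] that(1), unfolded dist_real_def]]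
        by (simp only: mult.commute[of 2] pos_less_divide_eq zero_less_numeral)
      finally show ?thesis .
    qed
    show "\<exists>M. \<forall>m\<ge>M. \<forall>n\<ge>M. dist (I (real m)) (I (real n)) < e"
      by (intro exI[of _ k] allI impI) (metis * dist_commute nat_le_linear)
  qed
  then obtain L where L: "(\<lambda>n. I (real n)) \<longlonglongrightarrow> L"
    by (metis Cauchy_convergent convergent_def)
  have bound: "norm (L - I N) \<le> 2 * (C * (pi / 2) - C * arctan N)" if N: "N \<ge> 0" for N
  proof (rule tendsto_le[OF sequentially_bot])
    show "(\<lambda>n. 2 * (C * arctan (real n) - C * arctan N)) \<longlonglongrightarrow> 2 * (C * (pi / 2) - C * arctan N)"
      by (intro tendsto_intros As)
    show "(\<lambda>n. norm (I (real n) - I N)) \<longlonglongrightarrow> norm (L - I N)"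
      by (intro tendsto_intros L)
    have "eventually (\<lambda>n. N \<le> real n) sequentially"
      using filterlim_real_sequentially unfolding filterlim_at_top by blast
    then show "eventually (\<lambda>n. norm (I (real n) - I N) \<le> 2 * (C * arctan (real n) - C * arctan N)) sequentially"
      by eventually_elim (use N split in \<open>auto simp: I_def\<close>)
  qed
  have "((\<lambda>N. I N - L) \<longlongrightarrow> 0) at_top"
  proof (rule Lim_null_comparison)
    show "eventually (\<lambda>N. norm (I N - L) \<le> 2 * (C * (pi / 2) - C * arctan N)) at_top"
      using eventually_ge_at_top[of 0] by eventually_elim (use bound in \<open>simp add: norm_minus_commute\<close>)
    have "((\<lambda>N. 2 * (C * (pi / 2) - C * arctan N)) \<longlongrightarrow> 2 * (C * (pi / 2) - C * (pi / 2))) at_top"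
      by (intro tendsto_intros tendsto_arctan_at_top)
    then show "((\<lambda>N. 2 * (C * (pi / 2) - C * arctan N)) \<longlongrightarrow> 0) at_top" by simp
  qed
  then show ?thesis unfolding I_def using LIM_zero_iff by blast
qed

lemma schwartz_integral_exists:
  assumes u: "continuous_on UNIV u" and lim: "(u \<longlongrightarrow> c) at_infinity" and \<zeta>: "\<zeta> \<in> half_plane"
  shows "schwartz_integrand u \<zeta> integrable_on {- N..N}"
    and "\<exists>L. ((\<lambda>N::real. integral {- N..N} (schwartz_integrand u \<zeta>)) \<longlongrightarrow> L) at_top"
proof -
  show "schwartz_integrand u \<zeta> integrable_on {- N..N}"
    by (intro integrable_continuous_interval schwartz_integrand_continuous u \<zeta>)
  obtain C where "\<And>t. norm (schwartz_integrand u \<zeta> t) \<le> C / (1 + t\<^sup>2)"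
    using schwartz_integrand_bound[OF assms] by blast
  then show "\<exists>L. ((\<lambda>N::real. integral {- N..N} (schwartz_integrand u \<zeta>)) \<longlongrightarrow> L) at_top"
    by (intro symmetric_integral_converges schwartz_integrand_continuous u \<zeta>)
qed

definition general_13_solution ::
    "(real \<Rightarrow> real) \<Rightarrow> (real \<Rightarrow> real) \<Rightarrow> real \<Rightarrow> real \<Rightarrow> biharm \<Rightarrow> biharm" where
  "general_13_solution u1 u3 a1 a2 \<zeta> =
     schwartz_integral u1 \<zeta> *\<^sub>B e1 + schwartz_integral u3 \<zeta> *\<^sub>B e2
       + a1 *\<^sub>R (\<i> *\<^sub>C e1) + a2 *\<^sub>R (\<i> *\<^sub>C e2)"

end

theory Submission
  imports Defs "HOL-Complex_Analysis.Complex_Analysis" "HOL-Real_Asymp.Real_Asymp"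
begin

text \<open>
  Since \<open>\<rho> = e2 - \<i> e1\<close> satisfies \<open>\<rho>\<^sup>2 = 0\<close>, one has \<open>\<zeta> = x e1 + y e2 = z + y \<rho>\<close> with
  \<open>z = x + \<i> y\<close>, and \<open>\<Phi>\<close> is monogenic iff \<open>\<Phi> = A + (y A' + G) \<rho>\<close> with \<open>A, G\<close> holomorphic in
  \<open>z\<close>. In particular \<open>S[u](\<zeta>) = s + y s' \<rho>\<close>, where \<open>s\<close> is the complex Schwartz integral of \<open>u\<close>.

  Existence: the Dini conditions make \<open>s\<close> extend continuously to the boundary and to infinity
  (dominated convergence for the Cauchy integral of \<open>u - u(\<infinity>)\<close>), and then Cauchy's estimate gives
  \<open>y s' \<rightarrow> 0\<close> there, so that the terms with \<open>y s'\<close> do not affect the boundary values.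

  Uniqueness: for a solution with zero data, \<open>y A' \<rightarrow> 0\<close> at the boundary for the same reason, so
  \<open>G\<close> and \<open>A - \<i> G\<close> are bounded, continuous up to the real line and imaginary there; Schwarz
  reflection and Liouville's theorem make them constant.
\<close>

section \<open>The biharmonic plane and holomorphic functions\<close>

text \<open>The \<open>e1\<close>-coefficient of A + B \<rho> is A - \<i> B and the
  \<open>e2\<close>-coefficient is B = y A' + G. Once y A' vanishes on the real line, the data
  prescribe Re (A - \<i> G) = u1 and Re G = u3 there, so the problem decouples into two scalar
  Schwarz problems. This is where A - \<i> G comes from, and why the solution formula puts s[u1] in
  the place of A - \<i> G and s[u3] in the place of G. The analytic obstacle is a majorant for the
  Cauchy integral that does not depend on z, also when Re z tends to infinity. The kernel is
  singular near t = Re z, where differences of u tame it, but the decay of u - u(\<infinity>) is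
  centred at t = 0. Translation by Re z fixes the first place and lets the second wander; hence a
  splitting in which one part is integrated in the original variable. The limit u(\<infinity>) is
  split off beforehand because a nonzero constant divided by t - z is not integrable; its share is
  computed in closed form as a symmetric limit.\<close>

definition plane_embed :: "complex \<Rightarrow> biharm" where
  "plane_embed z = plane_pt (Re z) (Im z)"

definition upper_half :: "complex set" where
  "upper_half = {z. Im z > 0}"

lemma plane_embed_eq: "plane_embed z = (complex_of_real (Re z), complex_of_real (Im z))"
  by (simp add: plane_embed_def plane_pt_def e1_def e2_def scaleR_conv_of_real)

lemma plane_pt_eq_embed: "plane_pt x y = plane_embed (Complex x y)"
  by (simp add: plane_embed_def)

lemma plane_embed_add: "plane_embed (z + w) = plane_embed z + plane_embed w"
  by (simp add: plane_embed_eq)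

lemma plane_embed_diff: "plane_embed (z - w) = plane_embed z - plane_embed w"
  by (simp add: plane_embed_eq)

lemma plane_embed_0 [simp]: "plane_embed 0 = 0"
  by (simp add: plane_embed_eq zero_prod_def)

lemma norm_plane_embed [simp]: "norm (plane_embed z) = cmod z"
  by (simp add: plane_embed_eq norm_Pair cmod_def)

lemma dist_plane_embed [simp]: "dist (plane_embed z) (plane_embed w) = dist z w"
  by (simp add: dist_norm plane_embed_diff[symmetric])

lemma plane_embed_eq_iff [simp]: "plane_embed z = plane_embed w \<longleftrightarrow> z = w"
  by (metis dist_eq_0_iff dist_plane_embed)

lemma half_plane_eq: "half_plane = plane_embed ` upper_half"
  unfolding half_plane_def upper_half_def plane_pt_eq_embed
  by (auto simp: image_iff) (metis complex.sel complex.collapse)+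

lemma closed_half_plane_eq: "closed_half_plane = plane_embed ` {z. Im z \<ge> 0}"
  unfolding closed_half_plane_def plane_pt_eq_embed
  by (auto simp: image_iff) (metis complex.sel complex.collapse)+

lemma biharm_plane_eq: "biharm_plane = range plane_embed"
  unfolding biharm_plane_def plane_pt_eq_embed
  by (auto simp: image_iff) (metis complex.sel complex.collapse)+

lemma plane_embed_in_half_plane [simp]: "plane_embed z \<in> half_plane \<longleftrightarrow> z \<in> upper_half"
  by (auto simp: half_plane_eq)

lemma open_upper_half: "open upper_half"
  unfolding upper_half_def by (rule open_halfspace_Im_gt)

lemma open_translated_upper_half: "open {h. z + h \<in> upper_half}"
proof -
  have "{h. z + h \<in> upper_half} = {h. Im h > - Im z}" by (auto simp: upper_half_def)
  then show ?thesis by (simp add: open_halfspace_Im_gt)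
qed

text \<open>Neighbourhoods are described by distances alone, and \<open>plane_embed\<close>
  preserves them. Stated as an equality of filters, it rewrites every limit in the plane into a
  limit in a complex variable, in both directions.\<close>

lemma at_within_plane_embed:
  "at (plane_embed z) within plane_embed ` S = filtermap plane_embed (at z within S)"
proof (rule filter_eqI)
  fix P
  show "eventually P (at (plane_embed z) within plane_embed ` S) \<longleftrightarrow>
      eventually P (filtermap plane_embed (at z within S))"
    unfolding eventually_filtermap eventually_at by auto
qed

lemma at_infinity_plane_embed:
  "inf at_infinity (principal (plane_embed ` S)) =
     filtermap plane_embed (inf at_infinity (principal S))"
proof (rule filter_eqI)
  fix P
  show "eventually P (inf at_infinity (principal (plane_embed ` S))) \<longleftrightarrow>
      eventually P (filtermap plane_embed (inf at_infinity (principal S)))"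
    unfolding eventually_filtermap eventually_inf_principal eventually_at_infinity
  proof (intro ex_cong1)
    fix b
    have "(\<forall>x. b \<le> norm x \<longrightarrow> x \<in> plane_embed ` S \<longrightarrow> P x) \<longleftrightarrow>
        (\<forall>x\<in>plane_embed ` S. b \<le> norm x \<longrightarrow> P x)" by blast
    also have "\<dots> \<longleftrightarrow> (\<forall>x. b \<le> norm x \<longrightarrow> x \<in> S \<longrightarrow> P (plane_embed x))"
      unfolding ball_simps norm_plane_embed by blast
    finally show "(\<forall>x. b \<le> norm x \<longrightarrow> x \<in> plane_embed ` S \<longrightarrow> P x) \<longleftrightarrow>
        (\<forall>x. b \<le> norm x \<longrightarrow> x \<in> S \<longrightarrow> P (plane_embed x))" .
  qed
qed

lemma continuous_on_plane_embed:
  "continuous_on (plane_embed ` S) f \<longleftrightarrow> continuous_on S (\<lambda>z. f (plane_embed z))"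
  by (simp add: continuous_on_def at_within_plane_embed filterlim_filtermap)

text \<open>The homomorphism \<open>e2 \<mapsto> \<i>\<close> of the algebra onto \<open>\<complex>\<close>; its kernel is spanned by the
  nilpotent element \<open>e2 - \<i> e1\<close>.\<close>

definition spectral :: "biharm \<Rightarrow> complex" where
  "spectral a = fst a + \<i> * snd a"

lemma spectral_mult: "spectral (a *\<^sub>B b) = spectral a * spectral b"
  by (simp add: spectral_def bmult_def algebra_simps)

text \<open>In the basis 1, \<rho> every a equals \<open>spectral a\<close> + \<open>snd a\<close>
  \<rho>, and since the square of \<rho> is 0 the coefficients of \<rho> obey a Leibniz
  rule.\<close>

lemma snd_bmult: "snd (a *\<^sub>B b) = spectral a * snd b + snd a * spectral b"
  by (simp add: spectral_def bmult_def algebra_simps)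

lemma spectral_diff: "spectral (a - b) = spectral a - spectral b"
  by (simp add: spectral_def algebra_simps)

text \<open>\<open>plane_embed h\<close> is h + (Im h) \<rho>, so its inverse is the truncated
  geometric series 1/h - (Im h / h^2) \<rho>.\<close>

lemma spectral_binv: "h \<noteq> 0 \<Longrightarrow> spectral (binv (plane_embed h)) = 1 / h"
  and snd_binv: "h \<noteq> 0 \<Longrightarrow> snd (binv (plane_embed h)) = - (complex_of_real (Im h) / h\<^sup>2)"
  by (auto simp: plane_embed_def binv_plane_pt complex_eq_iff spectral_def simp del: complex_eq_iff)
     (simp_all add: binv_plane_pt complex_eq_iff)

lemma tendsto_biharm_iff:
  "(f \<longlongrightarrow> l) F \<longleftrightarrow>
    ((\<lambda>x. spectral (f x)) \<longlongrightarrow> spectral l) F \<and> ((\<lambda>x. snd (f x)) \<longlongrightarrow> snd l) F"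
proof safe
  assume "(f \<longlongrightarrow> l) F"
  then show "((\<lambda>x. spectral (f x)) \<longlongrightarrow> spectral l) F" "((\<lambda>x. snd (f x)) \<longlongrightarrow> snd l) F"
    unfolding spectral_def using tendsto_fst[of f l F] tendsto_snd[of f l F]
    by (auto intro: tendsto_add tendsto_mult_left)
next
  assume a: "((\<lambda>x. spectral (f x)) \<longlongrightarrow> spectral l) F" and b: "((\<lambda>x. snd (f x)) \<longlongrightarrow> snd l) F"
  have "((\<lambda>x. spectral (f x) - \<i> * snd (f x)) \<longlongrightarrow> spectral l - \<i> * snd l) F"
    by (intro tendsto_diff tendsto_mult tendsto_const a b)
  then have "((\<lambda>x. fst (f x)) \<longlongrightarrow> fst l) F"
    by (simp add: spectral_def)
  from tendsto_Pair[OF this b] show "(f \<longlongrightarrow> l) F" by simp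
qed

section \<open>Monogenic functions as pairs of holomorphic functions\<close>

text \<open>The two limits are the coordinates, in the basis 1, \<rho>, of the increment of \<Phi>
  times the inverse of h. The first is complex differentiability of A; the second couples B to A
  through the nilpotent part of the inverse.\<close>

lemma monogenic_at_iff:
  fixes \<Phi> :: "biharm \<Rightarrow> biharm"
  fixes A B :: "complex \<Rightarrow> complex"
  assumes z: "z \<in> upper_half"
  defines "A \<equiv> \<lambda>z. spectral (\<Phi> (plane_embed z))" and "B \<equiv> \<lambda>z. snd (\<Phi> (plane_embed z))"
  shows "((\<lambda>h. (\<Phi> (plane_embed z + h) - \<Phi> (plane_embed z)) *\<^sub>B binv h) \<longlongrightarrow> D)
      (at 0 within {h \<in> biharm_plane. plane_embed z + h \<in> half_plane}) \<longleftrightarrow>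
    ((\<lambda>h. (A (z + h) - A z) / h) \<longlongrightarrow> spectral D) (at 0) \<and>
    ((\<lambda>h. (B (z + h) - B z) / h - Im h * (A (z + h) - A z) / h\<^sup>2) \<longlongrightarrow> snd D) (at 0)"
proof -
  have set: "{h \<in> biharm_plane. plane_embed z + h \<in> half_plane} =
      plane_embed ` {h. z + h \<in> upper_half}"
    by (auto simp: biharm_plane_eq plane_embed_add[symmetric])
  have at0: "at 0 within {h. z + h \<in> upper_half} = at 0"
    by (rule at_within_open[OF _ open_translated_upper_half]) (simp add: z)
  have flt: "at (0::biharm) within {h \<in> biharm_plane. plane_embed z + h \<in> half_plane}
      = filtermap plane_embed (at 0)"
    unfolding set using at_within_plane_embed[of 0 "{h. z + h \<in> upper_half}"] at0 by simp
  have e: "\<forall>\<^sub>F h in at (0::complex). h \<noteq> 0" by (simp add: eventually_at_filter)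
  have 1: "((\<lambda>h. (A (z + h) - A z) * spectral (binv (plane_embed h))) \<longlongrightarrow> spectral D) (at 0) \<longleftrightarrow>
      ((\<lambda>h. (A (z + h) - A z) / h) \<longlongrightarrow> spectral D) (at 0)"
    by (rule filterlim_cong[OF refl refl], rule eventually_mono[OF e]) (simp add: spectral_binv)
  have 2: "((\<lambda>h. (A (z + h) - A z) * snd (binv (plane_embed h)) +
        (B (z + h) - B z) * spectral (binv (plane_embed h))) \<longlongrightarrow> snd D) (at 0) \<longleftrightarrow>
      ((\<lambda>h. (B (z + h) - B z) / h - Im h * (A (z + h) - A z) / h\<^sup>2) \<longlongrightarrow> snd D) (at 0)"
    by (rule filterlim_cong[OF refl refl], rule eventually_mono[OF e]) (simp add: spectral_binv snd_binv)
  show ?thesis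
    unfolding flt filterlim_filtermap tendsto_biharm_iff[where l = D] spectral_mult snd_bmult
      plane_embed_add[symmetric] spectral_diff snd_diff
    using 1 2 unfolding A_def B_def by simp
qed

text \<open>The last limit is what makes the difference quotients of \<open>y A'(z)\<close> and of
  \<open>\<Phi>\<close> with respect to \<open>\<zeta>\<close> comparable.\<close>

lemma holomorphic_increments:
  assumes A: "A holomorphic_on upper_half" and z: "z \<in> upper_half"
  shows "((\<lambda>h::complex. (A (z + h) - A z) / h) \<longlongrightarrow> deriv A z) (at 0)"
    and "((\<lambda>h::complex. (deriv A (z + h) - deriv A z) / h) \<longlongrightarrow> deriv (deriv A) z) (at 0)"
    and "((\<lambda>h::complex. (deriv A (z + h) - (A (z + h) - A z) / h) * (complex_of_real (Im h) / h)) \<longlongrightarrow> 0) (at 0)"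
proof -
  have hA': "deriv A holomorphic_on upper_half"
    using A open_upper_half by (rule holomorphic_deriv)
  show dA: "((\<lambda>h::complex. (A (z + h) - A z) / h) \<longlongrightarrow> deriv A z) (at 0)"
    using holomorphic_derivI[OF A open_upper_half z, of UNIV] unfolding DERIV_def .
  show "((\<lambda>h::complex. (deriv A (z + h) - deriv A z) / h) \<longlongrightarrow> deriv (deriv A) z) (at 0)"
    using holomorphic_derivI[OF hA' open_upper_half z, of UNIV] unfolding DERIV_def .
  have "isCont (deriv A) z"
    using holomorphic_on_imp_continuous_on[OF hA'] open_upper_half z
    by (simp add: continuous_on_eq_continuous_at)
  then have cA': "((\<lambda>h::complex. deriv A (z + h)) \<longlongrightarrow> deriv A z) (at 0)"
    unfolding isCont_def by (subst (asm) LIM_offset_zero_iff) auto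
  have "((\<lambda>h::complex. deriv A (z + h) - (A (z + h) - A z) / h) \<longlongrightarrow> deriv A z - deriv A z) (at 0)"
    by (rule tendsto_diff[OF cA' dA])
  then have n: "((\<lambda>h::complex. cmod (deriv A (z + h) - (A (z + h) - A z) / h)) \<longlongrightarrow> 0) (at 0)"
    by (intro tendsto_norm_zero) simp
  \<comment> \<open>The quotient Im h / h has no limit at 0, but it is bounded by 1, so it is enough
    that the other factor tends to 0.\<close>
  have le: "cmod (w * (complex_of_real (Im h) / h)) \<le> cmod w" for w h :: complex
    unfolding norm_mult norm_divide
    by (intro mult_left_le) (auto simp: abs_Im_le_cmod divide_le_eq)
  show "((\<lambda>h::complex. (deriv A (z + h) - (A (z + h) - A z) / h) * (complex_of_real (Im h) / h)) \<longlongrightarrow> 0) (at 0)"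
    by (rule Lim_null_comparison[OF always_eventually n]) (intro allI le)
qed

lemma monogenic_onI:
  fixes A G :: "complex \<Rightarrow> complex"
  assumes A: "A holomorphic_on upper_half" and G: "G holomorphic_on upper_half"
    and \<Phi>: "\<And>z. z \<in> upper_half \<Longrightarrow> spectral (\<Phi> (plane_embed z)) = A z"
      "\<And>z. z \<in> upper_half \<Longrightarrow> snd (\<Phi> (plane_embed z)) = Im z * deriv A z + G z"
  shows "monogenic_on \<Phi> half_plane"
  unfolding monogenic_on_def
proof (rule ballI)
  fix \<zeta> assume "\<zeta> \<in> half_plane"
  then obtain z where z: "z \<in> upper_half" and \<zeta>: "\<zeta> = plane_embed z"
    by (auto simp: half_plane_eq)
  \<comment> \<open>The coefficient of \<rho> in the derivative A' + (G' + y A'') \<rho>. The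
    product rule for y A' also produces Im h times A'(z + h) / h; the correction by the increment of
    A cancels this term in the limit.\<close>
  define d where "d = deriv G z + complex_of_real (Im z) * deriv (deriv A) z"
  have "((\<lambda>h::complex. (G (z + h) - G z) / h + complex_of_real (Im z) * ((deriv A (z + h) - deriv A z) / h)
      + (deriv A (z + h) - (A (z + h) - A z) / h) * (complex_of_real (Im h) / h)) \<longlongrightarrow>
      deriv G z + complex_of_real (Im z) * deriv (deriv A) z + 0) (at 0)"
    by (rule tendsto_add[OF tendsto_add[OF holomorphic_increments(1)[OF G z]
        tendsto_mult[OF tendsto_const holomorphic_increments(2)[OF A z]]]
        holomorphic_increments(3)[OF A z]])
  then have lim: "((\<lambda>h::complex. (G (z + h) - G z) / h + complex_of_real (Im z) * ((deriv A (z + h) - deriv A z) / h)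
      + (deriv A (z + h) - (A (z + h) - A z) / h) * (complex_of_real (Im h) / h)) \<longlongrightarrow> d) (at 0)"
    by (simp only: d_def add_0_right)
  have ev: "\<forall>\<^sub>F h in at 0. h \<noteq> 0 \<and> z + h \<in> upper_half"
    using eventually_at_in_open[OF open_translated_upper_half, of 0 z] z
    by (simp add: conj_commute)
  define D where "D = (deriv A z - \<i> * d, d)"
  have D: "spectral D = deriv A z" "snd D = d" by (simp_all add: D_def spectral_def)
  have "((\<lambda>h. (\<Phi> (plane_embed z + h) - \<Phi> (plane_embed z)) *\<^sub>B binv h) \<longlongrightarrow> D)
      (at 0 within {h \<in> biharm_plane. plane_embed z + h \<in> half_plane})"
    unfolding monogenic_at_iff[OF z] D
  proof
    show "((\<lambda>h::complex. (spectral (\<Phi> (plane_embed (z + h))) - spectral (\<Phi> (plane_embed z))) / h)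
        \<longlongrightarrow> deriv A z) (at 0)"
      by (rule Lim_transform_eventually[OF holomorphic_increments(1)[OF A z] eventually_mono[OF ev]])
        (simp add: \<Phi>(1) z)
    \<comment> \<open>The increment of y A' + G is written out with \<open>y + b\<close> for Im (z +
      h) and \<open>k\<close> for the increment of A.\<close>
    have alg: "g / h + y * ((a' - a) / h) + (a' - k / h) * (b / h)
        = ((y + b) * a' + g1 - (y * a + g0)) / h - b * k / h\<^sup>2"
      if "g = g1 - g0" for g g0 g1 h y a a' k b :: complex
      unfolding that by (simp add: divide_inverse power2_eq_square algebra_simps)
    show "((\<lambda>h::complex. (snd (\<Phi> (plane_embed (z + h))) - snd (\<Phi> (plane_embed z))) / h
          - complex_of_real (Im h) * (spectral (\<Phi> (plane_embed (z + h))) - spectral (\<Phi> (plane_embed z))) / h\<^sup>2)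
        \<longlongrightarrow> d) (at 0)"
    proof (rule Lim_transform_eventually[OF lim], use ev in eventually_elim)
      case (elim h)
      then have h: "h \<noteq> 0" "z + h \<in> upper_half" by auto
      show ?case
        unfolding \<Phi>(1)[OF z] \<Phi>(1)[OF h(2)] \<Phi>(2)[OF z] \<Phi>(2)[OF h(2)] plus_complex.simps of_real_add
        by (rule alg[OF refl])
    qed
  qed
  then show "\<exists>D. ((\<lambda>h. (\<Phi> (\<zeta> + h) - \<Phi> \<zeta>) *\<^sub>B binv h) \<longlongrightarrow> D)
      (at 0 within {h \<in> biharm_plane. \<zeta> + h \<in> half_plane})"
    unfolding \<zeta> by blast
qed

text \<open>The first limit makes A holomorphic, so A'' exists. Subtracting y A'' and the vanishing
  correction from the second limit leaves exactly the difference quotient of B - y A'.\<close>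

lemma monogenic_onD:
  fixes A B :: "complex \<Rightarrow> complex"
  assumes "monogenic_on \<Phi> half_plane"
  defines "A \<equiv> \<lambda>z. spectral (\<Phi> (plane_embed z))" and "B \<equiv> \<lambda>z. snd (\<Phi> (plane_embed z))"
  shows "A holomorphic_on upper_half" "(\<lambda>z. B z - complex_of_real (Im z) * deriv A z) holomorphic_on upper_half"
proof -
  have ex: "\<exists>D. ((\<lambda>h::complex. (A (z + h) - A z) / h) \<longlongrightarrow> spectral D) (at 0) \<and>
    ((\<lambda>h::complex. (B (z + h) - B z) / h - complex_of_real (Im h) * (A (z + h) - A z) / h\<^sup>2) \<longlongrightarrow> snd D) (at 0)"
    if z: "z \<in> upper_half" for z
  proof -
    have "plane_embed z \<in> half_plane" using z by simp
    from bspec[OF assms(1)[unfolded monogenic_on_def] this]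
    obtain D where "((\<lambda>h. (\<Phi> (plane_embed z + h) - \<Phi> (plane_embed z)) *\<^sub>B binv h) \<longlongrightarrow> D)
        (at 0 within {h \<in> biharm_plane. plane_embed z + h \<in> half_plane})" ..
    then show ?thesis
      unfolding monogenic_at_iff[OF z] A_def B_def by (rule exI)
  qed
  have holo: "f holomorphic_on upper_half"
    if "\<And>z. z \<in> upper_half \<Longrightarrow> \<exists>D. (f has_field_derivative D) (at z)" for f :: "complex \<Rightarrow> complex"
    unfolding holomorphic_on_def field_differentiable_def
    using that has_field_derivative_at_within by blast
  show A: "A holomorphic_on upper_half"
  proof (rule holo)
    fix z assume "z \<in> upper_half"
    from ex[OF this] show "\<exists>D. (A has_field_derivative D) (at z)"
      unfolding DERIV_def by (elim exE conjE) (rule exI)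
  qed
  have "\<exists>D. ((\<lambda>z. B z - complex_of_real (Im z) * deriv A z) has_field_derivative D) (at z)"
    if z: "z \<in> upper_half" for z
  proof -
    obtain D where D: "((\<lambda>h::complex. (B (z + h) - B z) / h - complex_of_real (Im h) * (A (z + h) - A z) / h\<^sup>2) \<longlongrightarrow> D) (at 0)"
      using ex[OF z] by blast
    have lim: "((\<lambda>h::complex. ((B (z + h) - B z) / h - complex_of_real (Im h) * (A (z + h) - A z) / h\<^sup>2)
        - complex_of_real (Im z) * ((deriv A (z + h) - deriv A z) / h)
        - (deriv A (z + h) - (A (z + h) - A z) / h) * (complex_of_real (Im h) / h)) \<longlongrightarrow>
        D - complex_of_real (Im z) * deriv (deriv A) z - 0) (at 0)"
      by (rule tendsto_diff[OF tendsto_diff[OF D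
        tendsto_mult[OF tendsto_const holomorphic_increments(2)[OF A z]]]
        holomorphic_increments(3)[OF A z]])
    have alg: "b / h - y * k / h\<^sup>2 - x * ((a' - a) / h) - (a' - k / h) * (y / h)
        = (b1 - (x + y) * a' - (b0 - x * a)) / h"
      if "b = b1 - b0" for b b0 b1 h x y a a' k :: complex
      unfolding that by (simp add: divide_inverse power2_eq_square algebra_simps)
    have e: "\<forall>\<^sub>F h in at (0::complex). h \<noteq> 0" by (simp add: eventually_at_filter)
    have "((\<lambda>h::complex. (B (z + h) - Im (z + h) * deriv A (z + h) - (B z - complex_of_real (Im z) * deriv A z)) / h) \<longlongrightarrow>
        D - complex_of_real (Im z) * deriv (deriv A) z - 0) (at 0)"
    proof (rule Lim_transform_eventually[OF lim], use e in eventually_elim)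
      case (elim h)
      show ?case
        unfolding plus_complex.simps of_real_add by (rule alg[OF refl])
    qed
    then show ?thesis unfolding DERIV_def by (rule exI)
  qed
  then show "(\<lambda>z. B z - complex_of_real (Im z) * deriv A z) holomorphic_on upper_half"
    by (rule holo)
qed

section \<open>Boundary behaviour and the homogeneous problem\<close>

text \<open>Cauchy's estimate on the disc of radius Im z / 2, which stays inside the half-plane. The
  radius is proportional to Im z, so the factor Im z cancels and only the 2 remains. The constant c
  is subtracted so that B can be small near a limit of f.\<close>

lemma deriv_bound_upper_half:
  fixes f :: "complex \<Rightarrow> complex"
  assumes f: "f holomorphic_on upper_half" and z: "z \<in> upper_half"
    and B: "\<And>w. dist z w \<le> Im z / 2 \<Longrightarrow> cmod (f w - c) \<le> B"
  shows "cmod (complex_of_real (Im z) * deriv f z) \<le> 2 * B"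
proof -
  have y: "Im z > 0" using z by (simp add: upper_half_def)
  have sub: "cball z (Im z / 2) \<subseteq> upper_half"
  proof
    fix w assume "w \<in> cball z (Im z / 2)"
    then have "\<bar>Im z - Im w\<bar> \<le> Im z / 2"
      using abs_Im_le_cmod[of "z - w"] by (simp add: dist_norm)
    then have "Im w > 0" using y by linarith
    then show "w \<in> upper_half" by (simp add: upper_half_def)
  qed
  have holo: "(\<lambda>w. f w - c) holomorphic_on upper_half"
    by (intro holomorphic_intros f)
  have "norm ((deriv ^^ 1) (\<lambda>w. f w - c) z) \<le> fact 1 * B / (Im z / 2) ^ 1"
  proof (rule Cauchy_inequality)
    show "(\<lambda>w. f w - c) holomorphic_on ball z (Im z / 2)"
      using holomorphic_on_subset[OF holo] sub ball_subset_cball by blast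
    show "continuous_on (cball z (Im z / 2)) (\<lambda>w. f w - c)"
      using continuous_on_subset[OF holomorphic_on_imp_continuous_on[OF holo] sub] .
    show "cmod (f x - c) \<le> B" if "cmod (z - x) = Im z / 2" for x
      using B[of x] that by (simp add: dist_norm)
  qed (use y in simp)
  moreover have "deriv (\<lambda>w. f w - c) z = deriv f z"
    using holomorphic_derivI[OF f open_upper_half z, of UNIV]
    by (intro DERIV_imp_deriv) (auto intro!: derivative_eq_intros)
  ultimately show ?thesis using y by (simp add: norm_mult field_simps)
qed

lemma tendsto_Im_deriv:
  fixes f :: "complex \<Rightarrow> complex"
  assumes f: "f holomorphic_on upper_half" and lim: "(f \<longlongrightarrow> c) (at x within upper_half)"
    and x: "Im x = 0"
  shows "((\<lambda>z. complex_of_real (Im z) * deriv f z) \<longlongrightarrow> 0) (at x within upper_half)"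
proof (rule tendstoI)
  fix e :: real assume e: "e > 0"
  from tendstoD[OF lim, of "e / 4"] e obtain d where d: "d > 0"
    and *: "\<And>w. w \<in> upper_half \<Longrightarrow> w \<noteq> x \<Longrightarrow> dist w x < d \<Longrightarrow> dist (f w) c < e / 4"
    unfolding eventually_at by auto
  show "\<forall>\<^sub>F z in at x within upper_half. dist (complex_of_real (Im z) * deriv f z) 0 < e"
    unfolding eventually_at
  \<comment> \<open>As x is real, Im z is at most the distance from z to x. Points w of the disc
    around z are therefore within d/2 + d/4 < d of x, where f is within e/4 of c.\<close>
  proof (intro exI[of _ "d / 2"] conjI ballI impI)
    fix z assume z: "z \<in> upper_half" "z \<noteq> x \<and> dist z x < d / 2"
    have "cmod (complex_of_real (Im z) * deriv f z) \<le> 2 * (e / 4)"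
    proof (rule deriv_bound_upper_half[OF f z(1)])
      fix w assume w: "dist z w \<le> Im z / 2"
      have "Im z \<le> dist z x"
        using abs_Im_le_cmod[of "z - x"] x z(1) by (simp add: dist_norm upper_half_def)
      then have "dist w x < d"
        using dist_triangle[of w x z] w conjunct2[OF z(2)] d unfolding dist_commute[of z w] by linarith
      moreover have "Im w > 0"
        using abs_Im_le_cmod[of "z - w"] w z(1) by (auto simp: dist_norm upper_half_def)
      ultimately have "dist (f w) c < e / 4"
        using x by (intro *) (auto simp: upper_half_def)
      then show "cmod (f w - c) \<le> e / 4" by (simp add: dist_norm)
    qed
    then show "dist (complex_of_real (Im z) * deriv f z) 0 < e" using e by simp
  qed (use d in simp)
qed

lemma tendsto_Im_deriv_at_infinity:
  fixes f :: "complex \<Rightarrow> complex"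
  assumes f: "f holomorphic_on upper_half"
    and lim: "(f \<longlongrightarrow> c) (inf at_infinity (principal upper_half))"
  shows "((\<lambda>z. complex_of_real (Im z) * deriv f z) \<longlongrightarrow> 0) (inf at_infinity (principal upper_half))"
proof (rule tendstoI)
  fix e :: real assume e: "e > 0"
  from tendstoD[OF lim, of "e / 4"] e obtain b where
    *: "\<And>w. w \<in> upper_half \<Longrightarrow> cmod w \<ge> b \<Longrightarrow> dist (f w) c < e / 4"
    unfolding eventually_inf_principal eventually_at_infinity by auto
  show "\<forall>\<^sub>F z in inf at_infinity (principal upper_half). dist (complex_of_real (Im z) * deriv f z) 0 < e"
    unfolding eventually_inf_principal eventually_at_infinity
  \<comment> \<open>The disc around z has radius at most half of the modulus of z, so its points
    have modulus at least b.\<close>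
  proof (intro exI[of _ "2 * b"] allI impI)
    fix z assume z: "2 * b \<le> cmod z" "z \<in> upper_half"
    have "cmod (complex_of_real (Im z) * deriv f z) \<le> 2 * (e / 4)"
    proof (rule deriv_bound_upper_half[OF f z(2)])
      fix w assume w: "dist z w \<le> Im z / 2"
      have "Im z \<le> cmod z" using abs_Im_le_cmod[of z] by simp
      then have "b \<le> cmod w"
        using norm_triangle_ineq2[of z w] w z(1) by (simp add: dist_norm)
      moreover have "Im w > 0"
        using abs_Im_le_cmod[of "z - w"] w z(2) by (auto simp: dist_norm upper_half_def)
      ultimately have "dist (f w) c < e / 4"
        by (intro *) (auto simp: upper_half_def)
      then show "cmod (f w - c) \<le> e / 4" by (simp add: dist_norm)
    qed
    then show "dist (complex_of_real (Im z) * deriv f z) 0 < e" using e by simp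
  qed
qed

section \<open>The scalar problem with imaginary boundary values\<close>

lemma bounded_holomorphic_imaginary_boundary:
  fixes f :: "complex \<Rightarrow> complex"
  assumes f: "f holomorphic_on upper_half" and bd: "bounded (f ` upper_half)"
    and cont: "continuous_on {z. Im z \<ge> 0} f"
    and bdry: "\<And>x. Re (f (complex_of_real x)) = 0"
  obtains a where "\<And>z. Im z \<ge> 0 \<Longrightarrow> f z = \<i> * complex_of_real a"
proof -
  \<comment> \<open>Reflection requires real boundary values; the rotation turns imaginary ones into
    real ones.\<close>
  define g where "g z = - \<i> * f z" for z
  define h where "h z = (if 0 \<le> Im z then g z else cnj (g (cnj z)))" for z
  have greal: "g z \<in> \<real>" if "z \<in> \<real>" for z
    using that bdry by (auto simp: g_def elim!: Reals_cases intro!: complex_is_Real_iff[THEN iffD2])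
  have "h holomorphic_on UNIV"
    unfolding h_def
  proof (rule Schwarz_reflection)
    show "g holomorphic_on UNIV \<inter> {z. 0 < Im z}"
      using f unfolding g_def upper_half_def by (auto intro!: holomorphic_intros)
    show "continuous_on (UNIV \<inter> {z. 0 \<le> Im z}) g"
      using cont unfolding g_def by (auto intro!: continuous_intros)
  qed (use greal in auto)
  moreover have "bounded (range h)"
  proof -
    from bd obtain B where B: "\<And>z. z \<in> upper_half \<Longrightarrow> cmod (f z) \<le> B"
      by (auto simp: bounded_iff)
    \<comment> \<open>The bound is given on the open half-plane only; it reaches the real line by
      approaching z vertically.\<close>
    have "cmod (f z) \<le> B" if "Im z \<ge> 0" for z
    proof (rule tendsto_upperbound)
      have "((\<lambda>t. z + \<i> * complex_of_real t) \<longlongrightarrow> z + \<i> * complex_of_real 0) (at_right 0)"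
        by (intro tendsto_intros)
      then have "filterlim (\<lambda>t. z + \<i> * complex_of_real t) (at z within {z. Im z \<ge> 0}) (at_right 0)"
        using that unfolding filterlim_at
        by (intro conjI) (auto simp: eventually_at_filter intro!: always_eventually)
      from filterlim_compose[OF _ this, of f "nhds (f z)"]
      show "((\<lambda>t. cmod (f (z + \<i> * complex_of_real t))) \<longlongrightarrow> cmod (f z)) (at_right 0)"
        using cont that by (intro tendsto_norm) (auto simp: continuous_on_def)
      show "\<forall>\<^sub>F t in at_right 0. cmod (f (z + \<i> * complex_of_real t)) \<le> B"
        using that by (auto simp: eventually_at_filter upper_half_def intro!: always_eventually B)
    qed simp
    then have "cmod (h z) \<le> B" for z
      by (auto simp: h_def g_def norm_mult)
    then show ?thesis by (auto simp: bounded_iff)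
  qed
  ultimately obtain c where c: "\<And>z. h z = c"
    using Liouville_theorem unfolding constant_on_def by blast
  have "c \<in> \<real>" using c[of 0] greal[of 0] by (simp add: h_def)
  then obtain a where a: "c = complex_of_real a" by (auto elim: Reals_cases)
  have "f z = \<i> * complex_of_real a" if "Im z \<ge> 0" for z
  proof -
    have "- \<i> * f z = complex_of_real a" using c[of z] that by (simp add: h_def g_def a)
    then have "\<i> * (- \<i> * f z) = \<i> * complex_of_real a" by simp
    then show ?thesis by simp
  qed
  then show ?thesis by (rule that)
qed

lemma continuous_on_Im_deriv:
  fixes f :: "complex \<Rightarrow> complex"
  assumes f: "f holomorphic_on upper_half" and cont: "continuous_on {z. Im z \<ge> 0} f"
  shows "continuous_on {z. Im z \<ge> 0}
    (\<lambda>z. if z \<in> upper_half then complex_of_real (Im z) * deriv f z else 0)" (is "continuous_on _ ?g")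
  unfolding continuous_on_def
proof
  fix z assume "z \<in> {z. Im z \<ge> 0}"
  then consider "z \<in> upper_half" | "Im z = 0"
    by (auto simp: upper_half_def less_eq_real_def)
  then show "(?g \<longlongrightarrow> ?g z) (at z within {z. Im z \<ge> 0})"
  proof cases
    case 1
    have "continuous_on upper_half (\<lambda>z. complex_of_real (Im z) * deriv f z)"
      by (intro continuous_intros holomorphic_on_imp_continuous_on holomorphic_deriv f open_upper_half)
    then have "continuous_on upper_half ?g" by (rule continuous_on_eq) simp
    then have "isCont ?g z"
      using 1 by (simp only: continuous_on_eq_continuous_at[OF open_upper_half])
    then show ?thesis by (simp only: isCont_def tendsto_within_subset[OF _ subset_UNIV])
  next
    case 2
    \<comment> \<open>A boundary point is approached through interior points, where the derivative
      estimate applies, and along the real line, where the extension is identically 0.\<close>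
    have eq: "{z. Im z \<ge> 0} = upper_half \<union> {z. Im z = 0}" by (auto simp: upper_half_def)
    have "(f \<longlongrightarrow> f z) (at z within upper_half)"
      using cont 2 unfolding continuous_on_def upper_half_def
      by (auto intro: tendsto_within_subset[where S = "{z. Im z \<ge> 0}"])
    from tendsto_Im_deriv[OF f this 2]
    have 3: "(?g \<longlongrightarrow> 0) (at z within upper_half)"
      by (rule Lim_transform_eventually) (auto simp: eventually_at_filter intro!: always_eventually)
    have 4: "(?g \<longlongrightarrow> 0) (at z within {z. Im z = 0})"
      by (rule tendsto_eventually)
         (auto simp: eventually_at_filter upper_half_def intro!: always_eventually)
    have "?g z = 0" using 2 by (simp add: upper_half_def)
    then show ?thesis
      using 3 4 unfolding eq at_within_union by (simp only: filterlim_sup)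
  qed
qed

lemma bounded_upper_half:
  fixes f :: "complex \<Rightarrow> 'a :: real_normed_vector"
  assumes cont: "continuous_on {z. Im z \<ge> 0} f"
    and lim: "(f \<longlongrightarrow> L) (inf at_infinity (principal upper_half))"
  shows "bounded (f ` upper_half)"
proof -
  from tendstoD[OF lim, of 1] obtain b where
    b: "\<And>w. w \<in> upper_half \<Longrightarrow> cmod w \<ge> b \<Longrightarrow> dist (f w) L < 1"
    unfolding eventually_inf_principal eventually_at_infinity by auto
  have "compact (cball 0 b \<inter> {z. Im z \<ge> 0})"
    by (intro compact_Int_closed closed_halfspace_Im_ge) auto
  then have "bounded (f ` (cball 0 b \<inter> {z. Im z \<ge> 0}))"
    by (intro compact_imp_bounded compact_continuous_image continuous_on_subset[OF cont]) auto
  moreover have "f ` upper_half \<subseteq> f ` (cball 0 b \<inter> {z. Im z \<ge> 0}) \<union> cball L 1"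
  proof
    fix y assume "y \<in> f ` upper_half"
    then obtain w where w: "w \<in> upper_half" "y = f w" by auto
    show "y \<in> f ` (cball 0 b \<inter> {z. Im z \<ge> 0}) \<union> cball L 1"
    proof (cases "cmod w \<ge> b")
      case True
      from b[OF w(1) this] show ?thesis by (simp add: w(2) dist_commute)
    next
      case False
      then show ?thesis using w by (auto simp: upper_half_def)
    qed
  qed
  ultimately show ?thesis by (meson bounded_Un bounded_cball bounded_subset)
qed

lemma homogeneous_13_problem:
  assumes "solves_13_problem (\<lambda>_. 0) (\<lambda>_. 0) \<Psi>"
  obtains a1 a2 where "\<And>\<zeta>. \<zeta> \<in> half_plane \<Longrightarrow> \<Psi> \<zeta> = a1 *\<^sub>R (\<i> *\<^sub>C e1) + a2 *\<^sub>R (\<i> *\<^sub>C e2)"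
proof -
  define A B where "A z = spectral (\<Psi> (plane_embed z))" and "B z = snd (\<Psi> (plane_embed z))" for z
  from assms obtain L where cont: "continuous_on {z. Im z \<ge> 0} (\<lambda>z. \<Psi> (plane_embed z))"
    and mono: "monogenic_on \<Psi> half_plane"
    and lim: "((\<lambda>z. \<Psi> (plane_embed z)) \<longlongrightarrow> L) (inf at_infinity (principal upper_half))"
    and bdry: "\<And>x. Re (fst (\<Psi> (plane_embed (complex_of_real x)))) = 0"
      "\<And>x. Re (snd (\<Psi> (plane_embed (complex_of_real x)))) = 0"
    unfolding solves_13_problem_def U1_def U3_def closed_half_plane_eq half_plane_eq
      continuous_on_plane_embed at_infinity_plane_embed filterlim_filtermap plane_pt_eq_embed
      complex_of_real_def by blast
  have contA: "continuous_on {z. Im z \<ge> 0} A" and contB: "continuous_on {z. Im z \<ge> 0} B"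
    unfolding A_def B_def spectral_def by (intro continuous_intros cont)+
  have bdd: "bounded ((\<lambda>z. \<Psi> (plane_embed z)) ` upper_half)"
    by (rule bounded_upper_half[OF cont lim])
  then obtain K where K: "\<And>z. z \<in> upper_half \<Longrightarrow> norm (\<Psi> (plane_embed z)) \<le> K"
    by (auto simp: bounded_iff)
  have KB: "cmod (B z) \<le> K" if "z \<in> upper_half" for z
    using K[OF that] norm_snd_le[of "snd (\<Psi> (plane_embed z))" "fst (\<Psi> (plane_embed z))"]
    by (simp add: B_def)
  have KA: "cmod (A z) \<le> 2 * K" if "z \<in> upper_half" for z
  proof -
    have "cmod (A z) \<le> cmod (fst (\<Psi> (plane_embed z))) + cmod (B z)"
      using norm_triangle_ineq[of "fst (\<Psi> (plane_embed z))" "\<i> * B z"]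
      by (simp add: A_def B_def spectral_def norm_mult)
    also have "\<dots> \<le> 2 * K"
      using K[OF that] KB[OF that] norm_fst_le[of "fst (\<Psi> (plane_embed z))" "snd (\<Psi> (plane_embed z))"]
      by simp
    finally show ?thesis .
  qed
  have hA: "A holomorphic_on upper_half"
    and hG: "(\<lambda>z. B z - complex_of_real (Im z) * deriv A z) holomorphic_on upper_half"
    using monogenic_onD[OF mono] unfolding A_def[symmetric] B_def[symmetric] by simp_all
  \<comment> \<open>The non-holomorphic term y A', extended by 0 to the real line so that G and E
    below are continuous up to the boundary.\<close>
  define H where "H z = (if z \<in> upper_half then complex_of_real (Im z) * deriv A z else 0)" for z
  have contH: "continuous_on {z. Im z \<ge> 0} H"
    unfolding H_def using hA contA by (rule continuous_on_Im_deriv)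
  have KH: "cmod (H z) \<le> 4 * K" if "z \<in> upper_half" for z
  proof -
    have "cmod (complex_of_real (Im z) * deriv A z) \<le> 2 * (2 * K)"
    proof (rule deriv_bound_upper_half[OF hA that])
      fix w assume "dist z w \<le> Im z / 2"
      then have "\<bar>Im z - Im w\<bar> \<le> Im z / 2"
        using abs_Im_le_cmod[of "z - w"] by (simp add: dist_norm)
      moreover have "Im z > 0" using that by (simp add: upper_half_def)
      ultimately have "Im w > 0" by linarith
      then show "cmod (A w - 0) \<le> 2 * K" using KA[of w] by (simp add: upper_half_def)
    qed
    then show ?thesis using that by (simp add: H_def)
  qed
  define G where "G z = B z - H z" for z
  \<comment> \<open>On the real line H vanishes, so there G is the second component of \<Psi> and E
    = A - \<i> B is the first; both have real part 0 by the homogeneous data.\<close>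
  define E where "E z = A z - \<i> * G z" for z
  have hG': "G holomorphic_on upper_half"
    by (rule holomorphic_transform[OF hG]) (simp add: G_def H_def)
  have KG: "cmod (G z) \<le> 5 * K" if "z \<in> upper_half" for z
    using norm_triangle_ineq4[of "B z" "H z"] KB[OF that] KH[OF that] by (simp add: G_def)
  have KE: "cmod (E z) \<le> 7 * K" if "z \<in> upper_half" for z
    using norm_triangle_ineq4[of "A z" "\<i> * G z"] KA[OF that] KG[OF that]
    by (simp add: E_def norm_mult)
  have contG: "continuous_on {z. Im z \<ge> 0} G"
    unfolding G_def by (intro continuous_intros contB contH)
  have H0: "H (complex_of_real x) = 0" for x by (simp add: H_def upper_half_def)
  have "bounded (G ` upper_half)" "Re (G (complex_of_real x)) = 0" for x
    using KG bdry(2)[of x] by (auto simp: bounded_iff G_def H0 B_def)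
  from bounded_holomorphic_imaginary_boundary[OF hG' this(1) contG this(2)]
  obtain a2 where a2: "\<And>z. Im z \<ge> 0 \<Longrightarrow> G z = \<i> * complex_of_real a2" by blast
  have hE: "E holomorphic_on upper_half"
    unfolding E_def by (intro holomorphic_intros hA hG')
  have contE: "continuous_on {z. Im z \<ge> 0} E"
    unfolding E_def by (intro continuous_intros contA contG)
  have "bounded (E ` upper_half)" "Re (E (complex_of_real x)) = 0" for x
    using KE bdry(1)[of x] by (auto simp: bounded_iff E_def G_def H0 A_def B_def spectral_def)
  from bounded_holomorphic_imaginary_boundary[OF hE this(1) contE this(2)]
  obtain a1 where a1: "\<And>z. Im z \<ge> 0 \<Longrightarrow> E z = \<i> * complex_of_real a1" by blast
  have Aconst: "A z = \<i> * complex_of_real a1 - complex_of_real a2" if "Im z \<ge> 0" for z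
    using a1[OF that] a2[OF that] by (simp add: E_def algebra_simps)
  \<comment> \<open>Constancy of G determines B only up to H; since A is constant too, its
    derivative vanishes and B equals G.\<close>
  have H: "H z = 0" if z: "z \<in> upper_half" for z
  proof -
    have "((\<lambda>_. \<i> * complex_of_real a1 - complex_of_real a2) has_field_derivative 0) (at z)"
      by simp
    then have "(A has_field_derivative 0) (at z)"
      by (rule has_field_derivative_transform_within_open[OF _ open_upper_half z])
        (simp add: Aconst upper_half_def)
    then show ?thesis by (simp add: H_def DERIV_imp_deriv)
  qed
  show thesis
  proof (rule that)
    fix \<zeta> assume "\<zeta> \<in> half_plane"
    then obtain z where z: "z \<in> upper_half" and \<zeta>: "\<zeta> = plane_embed z" by (auto simp: half_plane_eq)
    then have Im: "Im z \<ge> 0" by (simp add: upper_half_def)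
    have "snd (\<Psi> \<zeta>) = \<i> * complex_of_real a2"
      using a2[OF Im] H[OF z] by (simp add: G_def B_def \<zeta>)
    moreover have "fst (\<Psi> \<zeta>) = \<i> * complex_of_real a1"
      using Aconst[OF Im] \<open>snd (\<Psi> \<zeta>) = _\<close> by (simp add: A_def spectral_def \<zeta>)
    ultimately show "\<Psi> \<zeta> = a1 *\<^sub>R (\<i> *\<^sub>C e1) + a2 *\<^sub>R (\<i> *\<^sub>C e2)"
      by (simp add: prod_eq_iff cscale_def e1_def e2_def scaleR_conv_of_real)
  qed
qed

lemma monogenic_on_diff:
  assumes "monogenic_on \<Phi> \<Omega>" "monogenic_on \<Psi> \<Omega>"
  shows "monogenic_on (\<lambda>\<zeta>. \<Phi> \<zeta> - \<Psi> \<zeta>) \<Omega>"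
  unfolding monogenic_on_def
proof
  fix \<zeta> assume "\<zeta> \<in> \<Omega>"
  let ?F = "at 0 within {h \<in> biharm_plane. \<zeta> + h \<in> \<Omega>}"
  from assms \<open>\<zeta> \<in> \<Omega>\<close> obtain D E where
    "((\<lambda>h. (\<Phi> (\<zeta> + h) - \<Phi> \<zeta>) *\<^sub>B binv h) \<longlongrightarrow> D) ?F"
    "((\<lambda>h. (\<Psi> (\<zeta> + h) - \<Psi> \<zeta>) *\<^sub>B binv h) \<longlongrightarrow> E) ?F"
    unfolding monogenic_on_def by meson
  from tendsto_diff[OF this]
  have "((\<lambda>h. (\<Phi> (\<zeta> + h) - \<Psi> (\<zeta> + h) - (\<Phi> \<zeta> - \<Psi> \<zeta>)) *\<^sub>B binv h) \<longlongrightarrow> D - E) ?F"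
    by (simp add: bmult_def algebra_simps)
  then show "\<exists>D. ((\<lambda>h. (\<Phi> (\<zeta> + h) - \<Psi> (\<zeta> + h) - (\<Phi> \<zeta> - \<Psi> \<zeta>)) *\<^sub>B binv h) \<longlongrightarrow> D) ?F" ..
qed

lemma solves_13_problem_diff:
  assumes "solves_13_problem u1 u3 \<Phi>" "solves_13_problem u1 u3 \<Psi>"
  shows "solves_13_problem (\<lambda>_. 0) (\<lambda>_. 0) (\<lambda>\<zeta>. \<Phi> \<zeta> - \<Psi> \<zeta>)"
proof -
  from assms obtain L M where
    "(\<Phi> \<longlongrightarrow> L) (inf at_infinity (principal half_plane))"
    "(\<Psi> \<longlongrightarrow> M) (inf at_infinity (principal half_plane))"
    unfolding solves_13_problem_def by auto
  from tendsto_diff[OF this] show ?thesis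
    using assms unfolding solves_13_problem_def
    by (intro conjI monogenic_on_diff continuous_on_diff exI[of _ "L - M"]) (auto simp: U1_def U3_def)
qed

section \<open>Majorants from the Dini conditions\<close>

text \<open>Finiteness of the nonnegative integral carries no measurability; monotonicity of the
  modulus supplies it.\<close>

lemma integrable_modulus:
  fixes w :: "real \<Rightarrow> real"
  assumes mono: "mono_on {0<..} w" and nonneg: "\<And>\<eta>. \<eta> > 0 \<Longrightarrow> w \<eta> \<ge> 0"
    and fin: "(\<integral>\<^sup>+\<eta>\<in>{0<..1}. ennreal (w \<eta> / \<eta>) \<partial>lborel) < \<infinity>"
  shows "integrable lborel (\<lambda>\<eta>. indicator {0<..1} \<eta> * (w \<eta> / \<eta>))"
proof (rule integrableI_nonneg)
  have "(\<lambda>\<eta>. indicator {0<..} \<eta> *\<^sub>R w \<eta>) \<in> borel_measurable borel"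
    using borel_measurable_mono_on_fnc[OF mono]
    by (subst (asm) borel_measurable_restrict_space_iff) auto
  then have "(\<lambda>\<eta>. indicator {0<..1} \<eta> * (indicator {0<..} \<eta> *\<^sub>R w \<eta> / \<eta>)) \<in> borel_measurable borel"
    by measurable
  also have "(\<lambda>\<eta>. indicator {0<..1} \<eta> * (indicator {0<..} \<eta> *\<^sub>R w \<eta> / \<eta>))
      = (\<lambda>\<eta>. indicator {0<..1} \<eta> * (w \<eta> / \<eta>))"
    by (auto simp: indicator_def)
  finally show "(\<lambda>\<eta>. indicator {0<..1} \<eta> * (w \<eta> / \<eta>)) \<in> borel_measurable lborel" by simp
  show "AE \<eta> in lborel. 0 \<le> indicator {0<..1} \<eta> * (w \<eta> / \<eta>)"
    using nonneg by (auto simp: indicator_def)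
  have "(\<integral>\<^sup>+ \<eta>. ennreal (indicator {0<..1} \<eta> * (w \<eta> / \<eta>)) \<partial>lborel) =
      (\<integral>\<^sup>+\<eta>\<in>{0<..1}. ennreal (w \<eta> / \<eta>) \<partial>lborel)"
    by (intro nn_integral_cong) (auto simp: indicator_def)
  then show "(\<integral>\<^sup>+ \<eta>. ennreal (indicator {0<..1} \<eta> * (w \<eta> / \<eta>)) \<partial>lborel) < \<infinity>"
    using fin by simp
qed

text \<open>The substitution \<eta> = 1/t. Applied to \<omega>(\<eta>) / \<eta>, with \<omega> the
  modulus at infinity, it gives \<omega>(1/t) / t on t \<ge> 1: the second Dini condition becomes
  integrability at infinity.\<close>

lemma integrable_inversion:
  fixes f :: "real \<Rightarrow> real"
  assumes f: "integrable lborel (\<lambda>\<eta>. indicator {0<..1} \<eta> * f \<eta>)"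
  shows "integrable lborel (\<lambda>t. indicator {1..} t * (f (1 / t) / t\<^sup>2))"
proof -
  have img: "(\<lambda>t::real. 1 / t) ` {1..} = {0<..1}"
    by (auto simp: image_iff intro!: bexI[of _ "1 / _"] )
  \<comment> \<open>The change of variables works with the completed measure; Borel measurability is
    proved separately in order to return to \<open>lborel\<close>.\<close>
  have m: "(\<lambda>t. indicator {1..} t * (f (1 / t) / t\<^sup>2)) \<in> borel_measurable lborel"
  proof -
    have [measurable]: "(\<lambda>\<eta>. indicator {0<..1} \<eta> * f \<eta>) \<in> borel_measurable borel"
      using f by (auto dest: borel_measurable_integrable)
    have "(\<lambda>t. indicator {1..} t * ((\<lambda>\<eta>. indicator {0<..1} \<eta> * f \<eta>) (1 / t) / t\<^sup>2)) \<in> borel_measurable borel"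
      by measurable
    also have "(\<lambda>t. indicator {1..} t * ((\<lambda>\<eta>. indicator {0<..1} \<eta> * f \<eta>) (1 / t) / t\<^sup>2)) =
        (\<lambda>t. indicator {1..} t * (f (1 / t) / t\<^sup>2))"
      by (auto simp: indicator_def)
    finally show ?thesis by simp
  qed
  have "integrable lebesgue (\<lambda>\<eta>. indicator {0<..1} \<eta> * f \<eta>)"
    using f borel_measurable_integrable[OF f] by (subst integrable_completion) auto
  then have "f absolutely_integrable_on ((\<lambda>t. 1 / t) ` {1..})"
    unfolding img set_integrable_def by simp
  moreover have "((\<lambda>t::real. 1 / t) has_field_derivative - (1 / t\<^sup>2)) (at t within {1..})"
    if "t \<in> {1..}" for t
    using that by (auto intro!: derivative_eq_intros simp: power2_eq_square)
  moreover have "inj_on (\<lambda>t::real. 1 / t) {1..}" by (auto simp: inj_on_def)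
  ultimately have "(\<lambda>t. \<bar>- (1 / t\<^sup>2)\<bar> * f (1 / t)) absolutely_integrable_on {1..}"
    using has_absolute_integral_change_of_variables_1'[of "{1..}" "\<lambda>t. 1 / t" "\<lambda>t. - (1 / t\<^sup>2)" f
        "integral ((\<lambda>t. 1 / t) ` {1..}) f"] by auto
  then have "integrable lebesgue (\<lambda>t. indicator {1..} t * (f (1 / t) / t\<^sup>2))"
    unfolding set_integrable_def by simp
  then show ?thesis using m by (simp add: integrable_completion)
qed

lemma bounded_of_limit_at_infinity:
  fixes u :: "real \<Rightarrow> real"
  assumes u: "continuous_on UNIV u" and lim: "(u \<longlongrightarrow> c) at_infinity"
  obtains B where "\<And>t. \<bar>u t - c\<bar> \<le> B"
proof -
  have "eventually (\<lambda>t. dist (u t) c < 1) at_infinity" using lim by (simp add: tendstoD)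
  then obtain b where b: "\<And>t. norm t \<ge> b \<Longrightarrow> dist (u t) c < 1"
    unfolding eventually_at_infinity by blast
  have "compact ((\<lambda>t. u t - c) ` {- b..b})"
    by (intro compact_continuous_image continuous_intros continuous_on_subset[OF u]) auto
  then obtain B where B: "\<And>t. t \<in> {- b..b} \<Longrightarrow> \<bar>u t - c\<bar> \<le> B"
    using compact_imp_bounded bounded_iff by (metis (mono_tags, lifting) image_eqI real_norm_def)
  have "\<bar>u t - c\<bar> \<le> max B 1" for t
  proof (cases "norm t \<ge> b")
    case True
    from b[OF this] show ?thesis by (auto simp: dist_real_def)
  next
    case False
    then have "t \<in> {- b..b}" by auto
    from B[OF this] show ?thesis by simp
  qed
  then show ?thesis by (rule that)
qed

section \<open>The moduli of continuity as genuine suprema\<close>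

lemma omega_R_bdd_above:
  fixes u :: "real \<Rightarrow> real" and c B :: real
  assumes B: "\<And>t. \<bar>u t - c\<bar> \<le> B"
  shows "bdd_above {\<bar>u \<tau>1 - u \<tau>2\<bar> | \<tau>1 \<tau>2. \<bar>\<tau>1 - \<tau>2\<bar> \<le> \<epsilon>}"
proof (rule bdd_aboveI[of _ "2 * B"], safe)
  fix s t show "\<bar>u s - u t\<bar> \<le> 2 * B" using B[of s] B[of t] by linarith
qed

lemma omega_R_ge:
  fixes u :: "real \<Rightarrow> real" and c B :: real
  assumes B: "\<And>t. \<bar>u t - c\<bar> \<le> B" and "\<bar>s - t\<bar> \<le> \<epsilon>"
  shows "\<bar>u s - u t\<bar> \<le> omega_R u \<epsilon>"
  unfolding omega_R_def using assms(2) by (intro cSup_upper omega_R_bdd_above[OF B]) auto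

lemma omega_R_mono_on:
  fixes u :: "real \<Rightarrow> real" and c B :: real
  assumes B: "\<And>t. \<bar>u t - c\<bar> \<le> B"
  shows "mono_on {0<..} (omega_R u)"
proof (rule mono_onI)
  fix r s :: real assume *: "r \<in> {0<..}" "r \<le> s"
  have "\<bar>u 0 - u 0\<bar> \<in> {\<bar>u \<tau>1 - u \<tau>2\<bar> | \<tau>1 \<tau>2. \<bar>\<tau>1 - \<tau>2\<bar> \<le> r}"
    by (rule CollectI, rule exI[of _ 0], rule exI[of _ 0]) (use * in simp)
  then show "omega_R u r \<le> omega_R u s"
    unfolding omega_R_def using *
    by (intro cSup_subset_mono omega_R_bdd_above[OF B]) (force+)
qed

lemma omega_R_inf_bdd_above:
  fixes u :: "real \<Rightarrow> real" and c B :: real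
  assumes B: "\<And>t. \<bar>u t - c\<bar> \<le> B" and lim: "(u \<longlongrightarrow> c) at_infinity"
  shows "bdd_above {\<bar>u \<tau> - Lim at_infinity u\<bar> | \<tau>. \<bar>\<tau>\<bar> \<ge> 1 / \<epsilon>}"
  unfolding tendsto_Lim[OF trivial_limit_at_infinity lim] using B by (auto intro!: bdd_aboveI[of _ B])

lemma omega_R_inf_ge:
  fixes u :: "real \<Rightarrow> real" and c B :: real
  assumes B: "\<And>t. \<bar>u t - c\<bar> \<le> B" and lim: "(u \<longlongrightarrow> c) at_infinity" and "\<bar>t\<bar> \<ge> 1 / \<epsilon>"
  shows "\<bar>u t - c\<bar> \<le> omega_R_inf u \<epsilon>"
  using assms(3) tendsto_Lim[OF trivial_limit_at_infinity lim] unfolding omega_R_inf_def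
  by (intro cSup_upper omega_R_inf_bdd_above[OF B lim]) auto

lemma omega_R_inf_mono_on:
  fixes u :: "real \<Rightarrow> real" and c B :: real
  assumes B: "\<And>t. \<bar>u t - c\<bar> \<le> B" and lim: "(u \<longlongrightarrow> c) at_infinity"
  shows "mono_on {0<..} (omega_R_inf u)"
proof (rule mono_onI)
  fix r s :: real assume *: "r \<in> {0<..}" "r \<le> s"
  have "\<bar>u (1 / r) - Lim at_infinity u\<bar> \<in> {\<bar>u \<tau> - Lim at_infinity u\<bar> | \<tau>. \<bar>\<tau>\<bar> \<ge> 1 / r}"
    by (rule CollectI, rule exI[of _ "1 / r"]) (use * in simp)
  moreover have "1 / s \<le> 1 / r" using * by (intro divide_left_mono) auto
  ultimately show "omega_R_inf u r \<le> omega_R_inf u s"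
    unfolding omega_R_inf_def
    by (intro cSup_subset_mono omega_R_inf_bdd_above[OF B lim]) (force+)
qed

text \<open>\<open>k1 \<tau>\<close> and \<open>k2 \<tau>\<close> stand for \<open>\<omega>(\<bar>\<tau>\<bar>) / \<bar>\<tau>\<bar>\<close> near \<open>0\<close> and \<open>\<omega>\<^sub>\<infinity>(2 / \<bar>\<tau>\<bar>) / \<bar>\<tau>\<bar>\<close> near
  infinity. The factor \<open>1 / 2\<close> in the last assumption makes \<open>\<bar>x + \<tau>\<bar> = \<bar>\<tau>\<bar> / 2\<close> a null set of \<open>\<tau>\<close>
  for every \<open>x\<close>; with \<open>1\<close> instead it would be everything for \<open>x = 0\<close>.\<close>

locale dini_density =
  fixes v k1 k2 :: "real \<Rightarrow> real" and B :: real
  assumes cont: "continuous_on UNIV v"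
    and lim0: "(v \<longlongrightarrow> 0) at_infinity"
    and bound: "\<bar>v t\<bar> \<le> B"
    and k1: "integrable lborel k1" "k1 \<tau> \<ge> 0"
      "\<tau> \<noteq> 0 \<Longrightarrow> \<bar>\<tau>\<bar> \<le> 1 \<Longrightarrow> \<bar>v (x + \<tau>) - v x\<bar> \<le> \<bar>\<tau>\<bar> * k1 \<tau>"
    and k2: "integrable lborel k2" "k2 \<tau> \<ge> 0"
      "\<bar>\<tau>\<bar> \<ge> 1 \<Longrightarrow> \<bar>t\<bar> \<ge> \<bar>\<tau>\<bar> / 2 \<Longrightarrow> \<bar>v t\<bar> \<le> \<bar>\<tau>\<bar> * k2 \<tau>"

lemma dini_density_exists:
  fixes u :: "real \<Rightarrow> real"
  assumes u: "continuous_on UNIV u" and lim: "(u \<longlongrightarrow> c) at_infinity" and dini: "dini_conditions u"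
  obtains k1 k2 B where "dini_density (\<lambda>t. u t - c) k1 k2 B"
proof -
  obtain B where B: "\<And>t. \<bar>u t - c\<bar> \<le> B"
    using bounded_of_limit_at_infinity[OF u lim] by blast
  have B0: "B \<ge> 0" using B[of 0] by linarith
  have nn1: "omega_R u \<eta> \<ge> 0" if "\<eta> > 0" for \<eta>
    using omega_R_ge[where u = u and c = c and B = B and s = 0 and t = 0 and \<epsilon> = \<eta>] B that by simp
  have nn2: "omega_R_inf u \<eta> \<ge> 0" if "\<eta> > 0" for \<eta>
    using omega_R_inf_ge[OF B lim, of \<eta> "1 / \<eta>"] that by simp
  define g where "g \<eta> = indicator {0<..1} \<eta> * (omega_R u \<eta> / \<eta>)" for \<eta>
  have g: "integrable lborel g"
    unfolding g_def using dini
    by (intro integrable_modulus omega_R_mono_on[OF B] nn1) (auto simp: dini_conditions_def)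
  define h where "h t = indicator {1..} t * (omega_R_inf u (1 / t) / (1 / t) / t\<^sup>2)" for t
  have h: "integrable lborel h"
    unfolding h_def using dini
    by (intro integrable_inversion integrable_modulus omega_R_inf_mono_on[OF B lim] nn2)
       (auto simp: dini_conditions_def)
  have g0: "g \<eta> \<ge> 0" for \<eta> using nn1 by (auto simp: g_def indicator_def)
  have h0: "h t \<ge> 0" for t using nn2 by (auto simp: h_def indicator_def)
  \<comment> \<open>An even function of \<tau>, because g vanishes at nonpositive arguments.\<close>
  define k1 where "k1 \<tau> = g \<tau> + g (- \<tau>)" for \<tau>
  \<comment> \<open>The function h lives on [1, \<infinity>), so h at half of the modulus of \<tau>
    only serves moduli from 2 on; the term with B covers the gap between 1 and 2.\<close>
  define k2 where "k2 \<tau> = B * indicator {-2..2} \<tau> + h (\<tau> / 2) + h (- \<tau> / 2)" for \<tau>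
  have "dini_density (\<lambda>t. u t - c) k1 k2 B"
  proof
    show "continuous_on UNIV (\<lambda>t. u t - c)" by (intro continuous_intros u)
    show "((\<lambda>t. u t - c) \<longlongrightarrow> 0) at_infinity" using lim by (simp add: LIM_zero)
    show "integrable lborel k1"
      unfolding k1_def using lborel_integrable_real_affine[OF g, of "-1" 0]
      by (intro Bochner_Integration.integrable_add g) simp
    show "k1 \<tau> \<ge> 0" "k2 \<tau> \<ge> 0" for \<tau>
      using g0 h0 B0 by (auto simp: k1_def k2_def)
    show "integrable lborel k2"
      unfolding k2_def
      using lborel_integrable_real_affine[OF h, of "1/2" 0] lborel_integrable_real_affine[OF h, of "-1/2" 0]
      by (intro Bochner_Integration.integrable_add integrable_mult_right integrable_real_indicator) auto
    show "\<bar>u t - c\<bar> \<le> B" for t by (rule B)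
    show "\<bar>u (x + \<tau>) - c - (u x - c)\<bar> \<le> \<bar>\<tau>\<bar> * k1 \<tau>" if "\<tau> \<noteq> 0" "\<bar>\<tau>\<bar> \<le> 1" for x \<tau>
    proof -
      have "\<bar>u (x + \<tau>) - c - (u x - c)\<bar> \<le> omega_R u \<bar>\<tau>\<bar>"
        using omega_R_ge[OF B, of "x + \<tau>" x "\<bar>\<tau>\<bar>"] by simp
      also have "\<dots> = \<bar>\<tau>\<bar> * g \<bar>\<tau>\<bar>" using that by (simp add: g_def)
      also have "g \<bar>\<tau>\<bar> \<le> k1 \<tau>" using g0[of \<tau>] g0[of "- \<tau>"] by (simp add: k1_def abs_if)
      finally show ?thesis using that by (simp add: mult_left_mono)
    qed
    show "\<bar>u t - c\<bar> \<le> \<bar>\<tau>\<bar> * k2 \<tau>" if "\<bar>\<tau>\<bar> \<ge> 1" "\<bar>t\<bar> \<ge> \<bar>\<tau>\<bar> / 2" for t \<tau>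
    proof (cases "\<bar>\<tau>\<bar> \<le> 2")
      case True
      then have "\<tau> \<in> {-2..2}" by auto
      then have "B \<le> k2 \<tau>" using h0[of "\<tau> / 2"] h0[of "- \<tau> / 2"] by (simp add: k2_def)
      then have "1 * B \<le> \<bar>\<tau>\<bar> * k2 \<tau>" using that B0 by (intro mult_mono) auto
      then show ?thesis using B[of t] by simp
    next
      case False
      have "\<bar>u t - c\<bar> \<le> omega_R_inf u (2 / \<bar>\<tau>\<bar>)"
        using that False by (intro omega_R_inf_ge[OF B lim]) auto
      \<comment> \<open>The factor 2 appears because h divides the modulus by half of
        \<bar>\<tau>\<bar> and not by \<bar>\<tau>\<bar> itself.\<close>
      also have "\<dots> \<le> 2 * omega_R_inf u (2 / \<bar>\<tau>\<bar>)" using nn2[of "2 / \<bar>\<tau>\<bar>"] False by simp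
      also have "\<dots> = \<bar>\<tau>\<bar> * h (\<bar>\<tau>\<bar> / 2)"
        using False by (simp add: h_def power2_eq_square field_simps)
      also have "h (\<bar>\<tau>\<bar> / 2) \<le> k2 \<tau>" using h0[of "\<tau> / 2"] h0[of "- \<tau> / 2"] B0 by (simp add: k2_def abs_if)
      finally show ?thesis by (simp add: mult_left_mono)
    qed
  qed
  then show ?thesis by (rule that)
qed

section \<open>The Cauchy integral of a Dini density\<close>

context dini_density
begin

definition cauchy :: "complex \<Rightarrow> complex" where
  "cauchy z = (\<integral>t. complex_of_real (v t) / (complex_of_real t - z) \<partial>lborel)"

definition cauchy_deriv :: "complex \<Rightarrow> complex" where
  "cauchy_deriv z = (\<integral>t. complex_of_real (v t) / (complex_of_real t - z)\<^sup>2 \<partial>lborel)"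

lemma measurable_v [measurable]: "v \<in> borel_measurable borel"
  using cont by (rule borel_measurable_continuous_onI)

lemma bound_nonneg: "B \<ge> 0"
  using bound[of 0] by linarith

section \<open>Integrability and holomorphy at fixed z\<close>

text \<open>An integrable majorant of \<bar>v t\<bar> / max 1 \<bar>t\<bar>. Away from the origin it
  is the defining property of \<open>k2\<close> with both points equal to t.\<close>

definition envelope :: "real \<Rightarrow> real" where
  "envelope t = B * indicator {-1..1} t + k2 t"

lemma integrable_envelope: "integrable lborel envelope"
  unfolding envelope_def using k2(1)
  by (intro Bochner_Integration.integrable_add integrable_mult_right integrable_real_indicator) auto

lemma envelope_nonneg: "envelope t \<ge> 0"
  using bound_nonneg k2(2) by (simp add: envelope_def)

lemma v_le_envelope: "\<bar>v t\<bar> \<le> max 1 \<bar>t\<bar> * envelope t"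
proof (cases "\<bar>t\<bar> \<le> 1")
  case True
  then have "t \<in> {-1..1}" by auto
  then show ?thesis using True bound[of t] k2(2)[of t] by (simp add: envelope_def)
next
  case False
  then have "t \<notin> {-1..1}" by auto
  then show ?thesis using False k2(3)[of t t] by (simp add: envelope_def max_def)
qed

lemma dist_real_ge_Im: "Im z \<le> cmod (complex_of_real t - z)"
  using abs_Im_le_cmod[of "complex_of_real t - z"] by simp

text \<open>The constant blows up at the boundary and at infinity. The estimate therefore gives
  integrability and holomorphy inside the half-plane, while the limits require the splitting
  below.\<close>

lemma max_le_dist:
  assumes "Im z > 0"
  shows "max 1 \<bar>t\<bar> \<le> (1 + 1 / Im z + cmod z / Im z) * cmod (complex_of_real t - z)"
proof -
  let ?d = "cmod (complex_of_real t - z)"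
  have y: "Im z \<le> ?d" by (rule dist_real_ge_Im)
  have 1: "1 \<le> ?d / Im z" using y assms by simp
  have "cmod z * 1 \<le> cmod z * (?d / Im z)" by (intro mult_left_mono 1) simp
  moreover have "\<bar>t\<bar> \<le> ?d + cmod z"
    using norm_triangle_ineq[of "complex_of_real t - z" z] by simp
  ultimately have "\<bar>t\<bar> \<le> ?d + cmod z / Im z * ?d" by simp
  moreover have "0 \<le> ?d / Im z" "0 \<le> cmod z / Im z * ?d" using assms by simp_all
  ultimately show ?thesis using 1 by (simp add: algebra_simps)
qed

lemma kernel_le:
  assumes "Im z > 0"
  shows "cmod (complex_of_real (v t) / (complex_of_real t - z))
    \<le> (1 + 1 / Im z + cmod z / Im z) * envelope t"
proof -
  have d: "cmod (complex_of_real t - z) > 0" using dist_real_ge_Im[of z t] assms by linarith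
  have "\<bar>v t\<bar> \<le> max 1 \<bar>t\<bar> * envelope t" by (rule v_le_envelope)
  also have "\<dots> \<le> (1 + 1 / Im z + cmod z / Im z) * cmod (complex_of_real t - z) * envelope t"
    by (intro mult_right_mono max_le_dist assms envelope_nonneg)
  finally show ?thesis using d by (simp add: norm_divide divide_le_eq mult_ac)
qed

lemma integrable_kernel:
  assumes "Im z > 0"
  shows "integrable lborel (\<lambda>t. complex_of_real (v t) / (complex_of_real t - z))"
  by (rule Bochner_Integration.integrable_bound[OF integrable_mult_right[OF integrable_envelope]])
     (use kernel_le[OF assms] in \<open>auto intro: order_trans[OF _ abs_ge_self]\<close>)

lemma integrable_kernel2:
  assumes "Im z > 0"
  shows "integrable lborel (\<lambda>t. complex_of_real (v t) / (complex_of_real t - z)\<^sup>2)"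
proof (rule Bochner_Integration.integrable_bound[OF integrable_mult_right[OF integrable_envelope]])
  show "AE t in lborel. cmod (complex_of_real (v t) / (complex_of_real t - z)\<^sup>2)
      \<le> norm (((1 + 1 / Im z + cmod z / Im z) / Im z) * envelope t)"
  proof (rule AE_I2)
    fix t
    have d: "cmod (complex_of_real t - z) \<ge> Im z" by (rule dist_real_ge_Im)
    have "cmod (complex_of_real (v t) / (complex_of_real t - z)\<^sup>2) =
        cmod (complex_of_real (v t) / (complex_of_real t - z)) / cmod (complex_of_real t - z)"
      by (simp add: norm_divide norm_mult power2_eq_square)
    also have "\<dots> \<le> ((1 + 1 / Im z + cmod z / Im z) * envelope t) / Im z"
      using d assms envelope_nonneg by (intro frac_le kernel_le mult_nonneg_nonneg) auto
    finally show "cmod (complex_of_real (v t) / (complex_of_real t - z)\<^sup>2)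
      \<le> norm (((1 + 1 / Im z + cmod z / Im z) / Im z) * envelope t)"
      unfolding real_norm_def times_divide_eq_left by (rule order_trans[OF _ abs_ge_self])
  qed
qed simp

text \<open>With a = t - w and b = t - z, the difference quotient of 1/(t - z) misses its derivative
  by exactly (w - z) / (a b^2), which is linear in w - z with an integrable coefficient.\<close>

lemma cauchy_has_derivative:
  assumes z: "Im z > 0"
  shows "(cauchy has_field_derivative cauchy_deriv z) (at z)"
  unfolding has_field_derivative_iff
proof (rule LIM_zero_cancel, rule Lim_null_comparison)
  define y where "y = Im z"
  have y: "y > 0" using z by (simp add: y_def)
  define K where "K = 1 + 1 / Im z + cmod z / Im z"
  have K0: "K \<ge> 0" using z by (simp add: K_def)
  \<comment> \<open>Of the three denominators, one factor t - z is absorbed with v into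
    \<open>K * envelope t\<close>; the other two are at least y and y/2.\<close>
  define M where "M = 2 * K / y\<^sup>2 * (\<integral>t. envelope t \<partial>lborel)"
  show "\<forall>\<^sub>F w in at z. cmod ((cauchy w - cauchy z) / (w - z) - cauchy_deriv z) \<le> M * cmod (w - z)"
    unfolding eventually_at
  proof (intro exI[of _ "y / 2"] conjI ballI impI)
    fix w assume "w \<noteq> z \<and> dist w z < y / 2"
    then have wz: "w \<noteq> z" and "cmod (w - z) < y / 2" by (auto simp: dist_norm)
    then have Imw: "Im w > y / 2" using abs_Im_le_cmod[of "w - z"] by (simp add: y_def)
    then have w: "Im w > 0" using y by linarith
    let ?f = "\<lambda>w t. complex_of_real (v t) / (complex_of_real t - w)"
    let ?f2 = "\<lambda>t. complex_of_real (v t) / (complex_of_real t - z)\<^sup>2"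
    have "(cauchy w - cauchy z) / (w - z) - cauchy_deriv z =
        (\<integral>t. (?f w t - ?f z t) / (w - z) - ?f2 t \<partial>lborel)"
      unfolding cauchy_def cauchy_deriv_def
      by (simp add: integrable_kernel integrable_kernel2 z w)
    also have "cmod \<dots> \<le> (\<integral>t. cmod (w - z) * (2 * K / y\<^sup>2) * envelope t \<partial>lborel)"
    proof (rule Bochner_Integration.integral_norm_bound_integral)
      show "integrable lborel (\<lambda>t. (?f w t - ?f z t) / (w - z) - ?f2 t)"
        by (intro Bochner_Integration.integrable_diff integrable_divide integrable_kernel
            integrable_kernel2 z w)
      show "integrable lborel (\<lambda>t. cmod (w - z) * (2 * K / y\<^sup>2) * envelope t)"
        by (intro integrable_mult_right integrable_envelope)
      fix t
      let ?a = "complex_of_real t - w" and ?b = "complex_of_real t - z"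
      have a: "cmod ?a \<ge> y / 2" using dist_real_ge_Im[of w t] Imw by linarith
      have b: "cmod ?b \<ge> y" using dist_real_ge_Im[of z t] by (simp add: y_def)
      have nz: "?a \<noteq> 0" "?b \<noteq> 0" using a b y by auto
      have alg: "(c / a - c / b) / d - c / b\<^sup>2 = d * (c / b) / (a * b)"
        if "d = b - a" "d \<noteq> 0" "a \<noteq> 0" "b \<noteq> 0" for a b c d :: complex
      proof -
        have "c / a - c / b = d * (c / (a * b))"
          unfolding that(1) using that by (simp add: field_simps)
        then have "(c / a - c / b) / d = c / (a * b)" using that by simp
        also have "\<dots> - c / b\<^sup>2 = d * (c / b) / (a * b)"
          unfolding that(1) using that(3,4) by (simp add: field_simps power2_eq_square)
        finally show ?thesis .
      qed
      have "(?f w t - ?f z t) / (w - z) - ?f2 t = (w - z) * ?f z t / (?a * ?b)"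
        by (rule alg) (use wz nz in auto)
      also have "cmod \<dots> = cmod (w - z) * cmod (?f z t) / (cmod ?a * cmod ?b)"
        by (simp add: norm_mult norm_divide)
      also have "\<dots> \<le> (cmod (w - z) * (K * envelope t)) / (y / 2 * y)"
        using a b y envelope_nonneg K0 kernel_le[OF z, of t, folded K_def]
        by (intro frac_le mult_mono mult_nonneg_nonneg) auto
      also have "\<dots> = cmod (w - z) * (2 * K / y\<^sup>2) * envelope t"
        using y by (simp add: power2_eq_square)
      finally show "cmod ((?f w t - ?f z t) / (w - z) - ?f2 t)
          \<le> cmod (w - z) * (2 * K / y\<^sup>2) * envelope t" .
    qed
    also have "\<dots> = M * cmod (w - z)" by (simp add: M_def mult_ac)
    finally show "cmod ((cauchy w - cauchy z) / (w - z) - cauchy_deriv z) \<le> M * cmod (w - z)" .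
  qed (use y in simp)
  have "((\<lambda>w. M * cmod (w - z)) \<longlongrightarrow> M * cmod (z - z)) (at z)" by (intro tendsto_intros)
  then show "((\<lambda>w. M * cmod (w - z)) \<longlongrightarrow> 0) (at z)" by simp
qed

lemma cauchy_holomorphic: "cauchy holomorphic_on upper_half"
  unfolding holomorphic_on_def field_differentiable_def upper_half_def
  using cauchy_has_derivative has_field_derivative_at_within by blast

text \<open>With \<open>z = x + \<i> y\<close> and \<open>t = x + \<tau>\<close>, the Cauchy integral splits into the parts
  \<open>\<bar>\<tau>\<bar> \<le> 1\<close> (with \<open>v x\<close> subtracted), \<open>\<bar>\<tau>\<bar> > 1\<close> with \<open>\<bar>t\<bar> \<ge> \<bar>\<tau>\<bar> / 2\<close>, and \<open>\<bar>\<tau>\<bar> > 1\<close> with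
  \<open>\<bar>t\<bar> < \<bar>\<tau>\<bar> / 2\<close>. The integrand is dominated independently of \<open>z\<close> by \<open>k1\<close>, \<open>k2\<close> and
  \<open>envelope\<close> respectively, for the last part in the variable \<open>t\<close>.\<close>

definition near :: "complex \<Rightarrow> real \<Rightarrow> complex" where
  "near z \<tau> = (if \<bar>\<tau>\<bar> \<le> 1 then complex_of_real (v (Re z + \<tau>) - v (Re z)) / (complex_of_real \<tau> - \<i> * Im z) else 0)"

definition middle :: "complex \<Rightarrow> real \<Rightarrow> complex" where
  "middle z \<tau> = (if \<bar>\<tau>\<bar> > 1 \<and> \<bar>Re z + \<tau>\<bar> \<ge> \<bar>\<tau>\<bar> / 2
     then complex_of_real (v (Re z + \<tau>)) / (complex_of_real \<tau> - \<i> * Im z) else 0)"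

definition far :: "complex \<Rightarrow> real \<Rightarrow> complex" where
  "far z t = (if \<bar>t - Re z\<bar> > 1 \<and> \<bar>t\<bar> < \<bar>t - Re z\<bar> / 2
     then complex_of_real (v t) / (complex_of_real t - z) else 0)"

section \<open>Majorants independent of z and the splitting\<close>

lemma measurable_parts [measurable]:
  "near z \<in> borel_measurable borel" "middle z \<in> borel_measurable borel" "far z \<in> borel_measurable borel"
  unfolding near_def[abs_def] middle_def[abs_def] far_def[abs_def] by measurable

lemma shifted_denominator_ge:
  "\<bar>\<tau>\<bar> \<le> cmod (complex_of_real \<tau> - \<i> * complex_of_real y)"
  "\<bar>y\<bar> \<le> cmod (complex_of_real \<tau> - \<i> * complex_of_real y)"
  using abs_Re_le_cmod[of "complex_of_real \<tau> - \<i> * complex_of_real y"]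
    abs_Im_le_cmod[of "complex_of_real \<tau> - \<i> * complex_of_real y"] by simp_all

lemma near_le: "cmod (near z \<tau>) \<le> k1 \<tau>"
proof (cases "\<tau> \<noteq> 0 \<and> \<bar>\<tau>\<bar> \<le> 1")
  case True
  have "cmod (near z \<tau>) = \<bar>v (Re z + \<tau>) - v (Re z)\<bar> / cmod (complex_of_real \<tau> - \<i> * complex_of_real (Im z))"
    using True by (simp add: near_def norm_divide del: of_real_diff)
  also have "\<dots> \<le> (\<bar>\<tau>\<bar> * k1 \<tau>) / \<bar>\<tau>\<bar>"
    using True k1(3)[of \<tau> "Re z"] by (intro frac_le shifted_denominator_ge) (auto simp: k1(2))
  finally show ?thesis using True by simp
next
  \<comment> \<open>This includes \<tau> = 0, where the numerator is
    \<open>v (Re z) - v (Re z)\<close>.\<close>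
  case False
  then show ?thesis using k1(2)[of \<tau>] by (auto simp: near_def)
qed

lemma middle_le: "cmod (middle z \<tau>) \<le> k2 \<tau>"
proof (cases "\<bar>\<tau>\<bar> > 1 \<and> \<bar>Re z + \<tau>\<bar> \<ge> \<bar>\<tau>\<bar> / 2")
  case True
  have "cmod (middle z \<tau>) = \<bar>v (Re z + \<tau>)\<bar> / cmod (complex_of_real \<tau> - \<i> * complex_of_real (Im z))"
    using True by (simp add: middle_def norm_divide)
  also have "\<dots> \<le> (\<bar>\<tau>\<bar> * k2 \<tau>) / \<bar>\<tau>\<bar>"
    using True k2(3)[of \<tau> "Re z + \<tau>"] by (intro frac_le shifted_denominator_ge) (auto simp: k2(2))
  finally show ?thesis using True by (auto split: if_splits)
next
  case False
  then show ?thesis using k2(2)[of \<tau>] by (auto simp: middle_def)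
qed

lemma far_le: "cmod (far z t) \<le> envelope t"
proof (cases "\<bar>t - Re z\<bar> > 1 \<and> \<bar>t\<bar> < \<bar>t - Re z\<bar> / 2")
  case True
  \<comment> \<open>In this region Re z is so far from t that the denominator dominates max 1
    \<bar>t\<bar> whatever z is.\<close>
  have "max 1 \<bar>t\<bar> \<le> \<bar>t - Re z\<bar>" using True by auto
  also have "\<dots> \<le> cmod (complex_of_real t - z)"
    using abs_Re_le_cmod[of "complex_of_real t - z"] by simp
  finally have d: "max 1 \<bar>t\<bar> \<le> cmod (complex_of_real t - z)" .
  have "cmod (far z t) = \<bar>v t\<bar> / cmod (complex_of_real t - z)"
    using True by (simp add: far_def norm_divide)
  also have "\<dots> \<le> (max 1 \<bar>t\<bar> * envelope t) / max 1 \<bar>t\<bar>"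
    by (intro frac_le v_le_envelope d) (auto simp: envelope_nonneg)
  finally show ?thesis by simp
next
  case False
  then show ?thesis using envelope_nonneg[of t] by (auto simp: far_def)
qed

lemma integrable_parts:
  "integrable lborel (near z)" "integrable lborel (middle z)" "integrable lborel (far z)"
proof -
  show "integrable lborel (near z)"
    by (rule Bochner_Integration.integrable_bound[OF k1(1)])
       (auto intro: order_trans[OF near_le abs_ge_self])
  show "integrable lborel (middle z)"
    by (rule Bochner_Integration.integrable_bound[OF k2(1)])
       (auto intro: order_trans[OF middle_le abs_ge_self])
  show "integrable lborel (far z)"
    by (rule Bochner_Integration.integrable_bound[OF integrable_envelope])
       (auto intro: order_trans[OF far_le abs_ge_self])
qed

text \<open>The antiderivative is, up to a constant, a branch of log (\<tau> - \<i> y). Its real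
  part is even in \<tau> and cancels between -1 and 1; the remaining arctan produces the jump of the
  Cauchy integral as y tends to 0.\<close>

lemma integral_kernel_near:
  assumes y: "y > 0"
  defines "f \<equiv> \<lambda>\<tau>::real. indicator {-1..1} \<tau> *\<^sub>R (1 / (complex_of_real \<tau> - \<i> * complex_of_real y))"
  shows "integrable lborel f" "integral\<^sup>L lborel f = 2 * \<i> * complex_of_real (arctan (1 / y))"
proof -
  define F where "F \<tau> = complex_of_real (ln (\<tau>\<^sup>2 + y\<^sup>2) / 2) + \<i> * complex_of_real (arctan (\<tau> / y))" for \<tau>
  have p: "\<tau>\<^sup>2 + y\<^sup>2 > 0" for \<tau> using y by (simp add: add_nonneg_pos)
  have nz: "complex_of_real \<tau> - \<i> * complex_of_real y \<noteq> 0" for \<tau>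
    using y by (auto simp: complex_eq_iff)
  have eq: "1 / (complex_of_real \<tau> - \<i> * complex_of_real y) =
      complex_of_real (\<tau> / (\<tau>\<^sup>2 + y\<^sup>2)) + \<i> * complex_of_real (y / (\<tau>\<^sup>2 + y\<^sup>2))" for \<tau>
    using p[of \<tau>] nz[of \<tau>]
    by (simp add: divide_eq_eq) (simp add: complex_eq_iff add_divide_distrib[symmetric] power2_eq_square)
  have d1: "((\<lambda>\<tau>. ln (\<tau>\<^sup>2 + y\<^sup>2) / 2) has_real_derivative \<tau> / (\<tau>\<^sup>2 + y\<^sup>2)) (at \<tau> within S)" for \<tau> S
  proof -
    have eq: "2 * \<tau> / (\<tau>\<^sup>2 + y\<^sup>2) / 2 = \<tau> / (\<tau>\<^sup>2 + y\<^sup>2)"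
      by (simp only: divide_divide_eq_left mult.commute[of _ 2] mult_divide_mult_cancel_left_if) simp
    have "((\<lambda>\<tau>. ln (\<tau>\<^sup>2 + y\<^sup>2)) has_real_derivative 2 * \<tau> / (\<tau>\<^sup>2 + y\<^sup>2)) (at \<tau> within S)"
      using p[of \<tau>] by (auto intro!: derivative_eq_intros)
    from DERIV_cdivide[OF this, of 2] show ?thesis unfolding eq .
  qed
  have d2: "((\<lambda>\<tau>. arctan (\<tau> / y)) has_real_derivative y / (\<tau>\<^sup>2 + y\<^sup>2)) (at \<tau> within S)" for \<tau> S
    using p[of \<tau>] y by (auto intro!: derivative_eq_intros simp: divide_simps power2_eq_square) 
  have "(F has_vector_derivative 1 / (complex_of_real \<tau> - \<i> * complex_of_real y)) (at \<tau> within S)" for \<tau> S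
    unfolding F_def eq
    by (intro has_vector_derivative_add has_vector_derivative_mult_right
        has_vector_derivative_of_real d1 d2)
  then have "has_bochner_integral lborel f (F 1 - F (-1))"
    unfolding f_def using nz
    by (intro has_bochner_integral_FTC_Icc) (auto intro!: continuous_intros)
  then show "integrable lborel f" "integral\<^sup>L lborel f = 2 * \<i> * complex_of_real (arctan (1 / y))"
    by (auto simp: has_bochner_integral_iff F_def arctan_minus)
qed

text \<open>The value \<open>v (Re z)\<close> subtracted in \<open>near\<close> is restored by the
  arctan term. The far part is translated back to t: in the variable \<tau> its majorant would move
  along with Re z.\<close>

lemma cauchy_split:
  assumes z: "Im z > 0"
  shows "cauchy z = integral\<^sup>L lborel (near z) + v (Re z) * (2 * \<i> * arctan (1 / Im z))
    + integral\<^sup>L lborel (middle z) + integral\<^sup>L lborel (far z)"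
proof -
  define x y where "x = Re z" and "y = Im z"
  have y: "y > 0" using z by (simp add: y_def)
  have zxy: "z = complex_of_real x + \<i> * complex_of_real y" by (simp add: x_def y_def complex_eq_iff)
  define f where "f = (\<lambda>\<tau>::real. indicator {-1..1} \<tau> *\<^sub>R (1 / (complex_of_real \<tau> - \<i> * complex_of_real y)))"
  have f: "integrable lborel f" "integral\<^sup>L lborel f = 2 * \<i> * complex_of_real (arctan (1 / y))"
    unfolding f_def by (rule integral_kernel_near[OF y])+
  have shift: "integral\<^sup>L lborel g = (\<integral>\<tau>. g (x + \<tau>) \<partial>lborel)" for g :: "real \<Rightarrow> complex"
    using lborel_integral_real_affine[of 1 g x] by simp
  have int_far: "integrable lborel (\<lambda>\<tau>. far z (x + \<tau>))"
    using lborel_integrable_real_affine[OF integrable_parts(3)[of z], of 1 x] by simp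
  have "cauchy z = (\<integral>\<tau>. complex_of_real (v (x + \<tau>)) / (complex_of_real (x + \<tau>) - z) \<partial>lborel)"
    unfolding cauchy_def by (rule shift)
  also have "\<dots> = (\<integral>\<tau>. near z \<tau> + complex_of_real (v x) * f \<tau> + middle z \<tau> + far z (x + \<tau>) \<partial>lborel)"
    by (rule Bochner_Integration.integral_cong[OF refl])
       (auto simp: near_def middle_def far_def f_def x_def[symmetric] y_def[symmetric] zxy indicator_def
         diff_divide_distrib)
  also have "\<dots> = integral\<^sup>L lborel (near z) + complex_of_real (v x) * integral\<^sup>L lborel f
      + integral\<^sup>L lborel (middle z) + (\<integral>\<tau>. far z (x + \<tau>) \<partial>lborel)"
    by (simp add: integrable_parts f(1) int_far)
  also have "(\<integral>\<tau>. far z (x + \<tau>) \<partial>lborel) = integral\<^sup>L lborel (far z)"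
    by (rule shift[symmetric])
  finally show ?thesis by (simp add: f(2) x_def y_def)
qed

end

section \<open>Tools for limits of integrals over moving regions\<close>

text \<open>Dominated convergence is applied along sequences, so the limit at infinity is reduced to
  them: a failure provides points of norm at least n at which f stays away from l.\<close>

lemma tendsto_at_infinity_within_sequentially:
  fixes f :: "'a::real_normed_vector \<Rightarrow> 'b::metric_space"
  assumes seq: "\<And>Z. \<lbrakk>\<And>n. Z n \<in> S; filterlim Z at_infinity sequentially\<rbrakk> \<Longrightarrow> (\<lambda>n. f (Z n)) \<longlonglongrightarrow> l"
  shows "(f \<longlongrightarrow> l) (inf at_infinity (principal S))"
proof (rule tendstoI, rule ccontr)
  fix e :: real assume e: "e > 0"
    and "\<not> (\<forall>\<^sub>F z in inf at_infinity (principal S). dist (f z) l < e)"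
  then have "\<exists>z. z \<in> S \<and> real n \<le> norm z \<and> \<not> dist (f z) l < e" for n
    unfolding eventually_inf_principal eventually_at_infinity by auto
  then obtain Z where Z: "\<And>n. Z n \<in> S" "\<And>n. real n \<le> norm (Z n)" "\<And>n. \<not> dist (f (Z n)) l < e"
    by metis
  have "filterlim Z at_infinity sequentially"
    by (rule filterlim_norm_at_top_imp_at_infinity, rule filterlim_at_top_mono[OF filterlim_real_sequentially])
      (use Z(2) in auto)
  from tendstoD[OF seq[OF Z(1) this] e] Z(3) show False
    by (simp add: eventually_sequentially)
qed

text \<open>The regions of the splitting move with Re z. For a point not on the boundary of the
  limiting region, membership is the sign of a quantity with nonzero limit and hence
  stabilises.\<close>

lemma tendsto_eventually_sign:
  fixes d :: "'a \<Rightarrow> real"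
  assumes "(d \<longlongrightarrow> a) F" "a \<noteq> 0"
  shows "\<forall>\<^sub>F n in F. (0 \<le> d n \<longleftrightarrow> 0 \<le> a) \<and> (0 < d n \<longleftrightarrow> 0 < a)"
proof (cases "a > 0")
  case True
  from order_tendstoD(1)[OF assms(1) this] show ?thesis
    by (rule eventually_mono) (use True in auto)
next
  case False
  then have "a < 0" using assms(2) by simp
  from order_tendstoD(2)[OF assms(1) this] show ?thesis
    by (rule eventually_mono) (use False assms(2) in auto)
qed

lemma tendsto_If_eventually:
  assumes "\<forall>\<^sub>F n in F. P n \<longleftrightarrow> Q" and "Q \<Longrightarrow> (f \<longlongrightarrow> a) F"
  shows "((\<lambda>n. if P n then f n else c) \<longlongrightarrow> (if Q then a else c)) F"
proof (cases Q)
  case True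
  show ?thesis
    by (rule Lim_transform_eventually[of f]) (use True assms(2) eventually_mono[OF assms(1)] in auto)
next
  case False
  show ?thesis
    by (rule Lim_transform_eventually[of "\<lambda>_. c"]) (use False eventually_mono[OF assms(1)] in auto)
qed

lemma arctan_le_self:
  assumes "0 \<le> x"
  shows "arctan x \<le> x"
proof -
  have "0 - arctan 0 \<le> x - arctan x"
  proof (rule DERIV_nonneg_imp_nondecreasing[OF assms])
    fix t :: real
    have "((\<lambda>x. x - arctan x) has_real_derivative 1 - inverse (1 + t\<^sup>2)) (at t)"
      by (auto intro!: derivative_eq_intros)
    moreover have "0 \<le> 1 - inverse (1 + t\<^sup>2)"
      using inverse_le_1_iff[of "1 + t\<^sup>2"] by simp
    ultimately show "\<exists>y. ((\<lambda>x. x - arctan x) has_real_derivative y) (at t) \<and> 0 \<le> y" by blast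
  qed
  then show ?thesis by simp
qed

context dini_density
begin

section \<open>Boundary values of the Cauchy integral\<close>

lemma cauchy_tendsto_sequentially:
  assumes Z: "\<And>n. Im (Z n) > 0"
    and [measurable]: "g1 \<in> borel_measurable borel" "g2 \<in> borel_measurable borel" "g3 \<in> borel_measurable borel"
    and 1: "AE \<tau> in lborel. (\<lambda>n. near (Z n) \<tau>) \<longlonglongrightarrow> g1 \<tau>"
    and 2: "AE \<tau> in lborel. (\<lambda>n. middle (Z n) \<tau>) \<longlonglongrightarrow> g2 \<tau>"
    and 3: "AE t in lborel. (\<lambda>n. far (Z n) t) \<longlonglongrightarrow> g3 t"
    and l: "(\<lambda>n. complex_of_real (v (Re (Z n))) * (2 * \<i> * complex_of_real (arctan (1 / Im (Z n))))) \<longlonglongrightarrow> l"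
  shows "(\<lambda>n. cauchy (Z n)) \<longlonglongrightarrow>
    integral\<^sup>L lborel g1 + l + integral\<^sup>L lborel g2 + integral\<^sup>L lborel g3"
  unfolding cauchy_split[OF Z]
proof (intro tendsto_add)
  show "(\<lambda>n. integral\<^sup>L lborel (near (Z n))) \<longlonglongrightarrow> integral\<^sup>L lborel g1"
    using near_le by (intro integral_dominated_convergence[OF _ _ k1(1) 1]) auto
  show "(\<lambda>n. integral\<^sup>L lborel (middle (Z n))) \<longlonglongrightarrow> integral\<^sup>L lborel g2"
    using middle_le by (intro integral_dominated_convergence[OF _ _ k2(1) 2]) auto
  show "(\<lambda>n. integral\<^sup>L lborel (far (Z n))) \<longlonglongrightarrow> integral\<^sup>L lborel g3"
    using far_le by (intro integral_dominated_convergence[OF _ _ integrable_envelope 3]) auto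
  show "(\<lambda>n. complex_of_real (v (Re (Z n))) * (2 * \<i> * complex_of_real (arctan (1 / Im (Z n))))) \<longlonglongrightarrow> l"
    by (rule l)
qed

text \<open>The Sokhotski-Plemelj formula from above. Of the principal value r only its being real
  matters: the limits of the three integrands are real, and all of the imaginary part comes from the
  arctan term.\<close>

lemma cauchy_tendsto_boundary:
  obtains r :: real where
    "(cauchy \<longlongrightarrow> complex_of_real r + \<i> * complex_of_real (pi * v x)) (at (complex_of_real x) within upper_half)"
proof -
  define g1 where "g1 \<tau> = (if \<bar>\<tau>\<bar> \<le> 1 then (v (x + \<tau>) - v x) / \<tau> else 0)" for \<tau>
  define g2 where "g2 \<tau> = (if \<bar>\<tau>\<bar> > 1 \<and> \<bar>x + \<tau>\<bar> \<ge> \<bar>\<tau>\<bar> / 2 then v (x + \<tau>) / \<tau> else 0)" for \<tau>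
  define g3 where "g3 t = (if \<bar>t - x\<bar> > 1 \<and> \<bar>t\<bar> < \<bar>t - x\<bar> / 2 then v t / (t - x) else 0)" for t
  have [measurable]: "g1 \<in> borel_measurable borel" "g2 \<in> borel_measurable borel" "g3 \<in> borel_measurable borel"
    unfolding g1_def[abs_def] g2_def[abs_def] g3_def[abs_def] by measurable
  define r where "r = integral\<^sup>L lborel g1 + integral\<^sup>L lborel g2 + integral\<^sup>L lborel g3"
  have "(cauchy \<longlongrightarrow> complex_of_real r + \<i> * complex_of_real (pi * v x)) (at (complex_of_real x) within upper_half)"
    unfolding tendsto_at_iff_sequentially
  proof (intro allI impI)
    fix Z assume "\<forall>n. Z n \<in> upper_half - {complex_of_real x}" and Zx: "Z \<longlonglongrightarrow> complex_of_real x"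
    then have Z: "\<And>n. Im (Z n) > 0" by (auto simp: upper_half_def)
    have X: "(\<lambda>n. Re (Z n)) \<longlonglongrightarrow> x" using tendsto_Re[OF Zx] by simp
    have Y: "(\<lambda>n. Im (Z n)) \<longlonglongrightarrow> 0" using tendsto_Im[OF Zx] by simp
    have v: "(\<lambda>n. v (p n)) \<longlonglongrightarrow> v q" if "p \<longlonglongrightarrow> q" for p q
      using cont that by (simp add: continuous_on_eq_continuous_at isCont_tendsto_compose)
    have den: "(\<lambda>n. complex_of_real \<tau> - \<i> * complex_of_real (Im (Z n))) \<longlonglongrightarrow> complex_of_real \<tau> - \<i> * complex_of_real 0" for \<tau>
      by (intro tendsto_intros Y)
    have 1: "(\<lambda>n. near (Z n) \<tau>) \<longlonglongrightarrow> complex_of_real (g1 \<tau>)" if "\<tau> \<noteq> 0" for \<tau>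
    proof -
      have "(\<lambda>n. complex_of_real (v (Re (Z n) + \<tau>) - v (Re (Z n))) / (complex_of_real \<tau> - \<i> * complex_of_real (Im (Z n))))
          \<longlonglongrightarrow> complex_of_real (v (x + \<tau>) - v x) / (complex_of_real \<tau> - \<i> * complex_of_real 0)"
        using that by (intro tendsto_divide den tendsto_of_real tendsto_diff v tendsto_add X tendsto_const) simp
      then show ?thesis by (simp add: near_def g1_def)
    qed
    have 2: "(\<lambda>n. middle (Z n) \<tau>) \<longlonglongrightarrow> complex_of_real (g2 \<tau>)"
      \<comment> \<open>The last two values are the solutions of \<bar>x + \<tau>\<bar> =
        \<bar>\<tau>\<bar> / 2. The cut at \<bar>\<tau>\<bar> = 1 does not move with n.\<close>
      if "\<tau> \<noteq> 0" "\<tau> \<noteq> - 2 * x" "\<tau> \<noteq> - 2 * x / 3" for \<tau>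
    proof -
      have "(\<lambda>n. \<bar>Re (Z n) + \<tau>\<bar> - \<bar>\<tau>\<bar> / 2) \<longlonglongrightarrow> \<bar>x + \<tau>\<bar> - \<bar>\<tau>\<bar> / 2"
        by (intro tendsto_diff tendsto_rabs tendsto_add X tendsto_const)
      moreover have "\<bar>x + \<tau>\<bar> - \<bar>\<tau>\<bar> / 2 \<noteq> 0" using that by linarith
      ultimately have "\<forall>\<^sub>F n in sequentially. \<bar>Re (Z n) + \<tau>\<bar> \<ge> \<bar>\<tau>\<bar> / 2 \<longleftrightarrow> \<bar>x + \<tau>\<bar> \<ge> \<bar>\<tau>\<bar> / 2"
        by (rule eventually_mono[OF tendsto_eventually_sign]) simp
      then have ev: "\<forall>\<^sub>F n in sequentially. (\<bar>\<tau>\<bar> > 1 \<and> \<bar>Re (Z n) + \<tau>\<bar> \<ge> \<bar>\<tau>\<bar> / 2) \<longleftrightarrow> (\<bar>\<tau>\<bar> > 1 \<and> \<bar>x + \<tau>\<bar> \<ge> \<bar>\<tau>\<bar> / 2)"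
        by (rule eventually_mono) simp
      have "(\<lambda>n. complex_of_real (v (Re (Z n) + \<tau>)) / (complex_of_real \<tau> - \<i> * complex_of_real (Im (Z n))))
          \<longlonglongrightarrow> complex_of_real (v (x + \<tau>)) / (complex_of_real \<tau> - \<i> * complex_of_real 0)"
        using that by (intro tendsto_divide den tendsto_of_real v tendsto_add X tendsto_const) simp
      moreover have "complex_of_real (g2 \<tau>) = (if \<bar>\<tau>\<bar> > 1 \<and> \<bar>x + \<tau>\<bar> \<ge> \<bar>\<tau>\<bar> / 2
          then complex_of_real (v (x + \<tau>)) / (complex_of_real \<tau> - \<i> * complex_of_real 0) else 0)"
        by (simp add: g2_def)
      ultimately show ?thesis
        unfolding middle_def by (simp only:) (rule tendsto_If_eventually[OF ev])
    qed
    have 3: "(\<lambda>n. far (Z n) t) \<longlonglongrightarrow> complex_of_real (g3 t)"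
      \<comment> \<open>The first two values solve \<bar>t\<bar> = \<bar>t - x\<bar> / 2, the other
        two \<bar>t - x\<bar> = 1. In the variable t both conditions move with n.\<close>
      if "t \<noteq> - x" "t \<noteq> x / 3" "t \<noteq> x - 1" "t \<noteq> x + 1" for t
    proof -
      have "(\<lambda>n. \<bar>t - Re (Z n)\<bar> / 2 - \<bar>t\<bar>) \<longlonglongrightarrow> \<bar>t - x\<bar> / 2 - \<bar>t\<bar>"
        by (intro tendsto_diff tendsto_rabs X tendsto_const tendsto_divide) simp
      moreover have "\<bar>t - x\<bar> / 2 - \<bar>t\<bar> \<noteq> 0"
        using that(1,2) by (auto simp: abs_if field_simps split: if_splits)
      ultimately have ev1: "\<forall>\<^sub>F n in sequentially. (\<bar>t\<bar> < \<bar>t - Re (Z n)\<bar> / 2) \<longleftrightarrow> (\<bar>t\<bar> < \<bar>t - x\<bar> / 2)"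
        by (rule eventually_mono[OF tendsto_eventually_sign]) simp
      have "(\<lambda>n. \<bar>t - Re (Z n)\<bar> - 1) \<longlonglongrightarrow> \<bar>t - x\<bar> - 1"
        by (intro tendsto_diff tendsto_rabs X tendsto_const)
      moreover have "\<bar>t - x\<bar> - 1 \<noteq> 0" using that(3,4) by linarith
      ultimately have ev2: "\<forall>\<^sub>F n in sequentially. (\<bar>t - Re (Z n)\<bar> > 1) \<longleftrightarrow> (\<bar>t - x\<bar> > 1)"
        by (rule eventually_mono[OF tendsto_eventually_sign]) simp
      from ev1 ev2 have ev: "\<forall>\<^sub>F n in sequentially. (\<bar>t - Re (Z n)\<bar> > 1 \<and> \<bar>t\<bar> < \<bar>t - Re (Z n)\<bar> / 2) \<longleftrightarrow>
          (\<bar>t - x\<bar> > 1 \<and> \<bar>t\<bar> < \<bar>t - x\<bar> / 2)"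
        by eventually_elim simp
      have "(\<lambda>n. complex_of_real (v t) / (complex_of_real t - Z n)) \<longlonglongrightarrow> complex_of_real (v t) / (complex_of_real t - complex_of_real x)"
        if "\<bar>t - x\<bar> > 1 \<and> \<bar>t\<bar> < \<bar>t - x\<bar> / 2"
        using that by (intro tendsto_divide tendsto_diff Zx tendsto_const) auto
      moreover have "complex_of_real (g3 t) = (if \<bar>t - x\<bar> > 1 \<and> \<bar>t\<bar> < \<bar>t - x\<bar> / 2
          then complex_of_real (v t) / (complex_of_real t - complex_of_real x) else 0)"
        by (simp add: g3_def)
      ultimately show ?thesis
        unfolding far_def by (simp only:) (rule tendsto_If_eventually[OF ev])
    qed
    \<comment> \<open>Approach from above decides the sign of the jump: arctan tends to
      +\<pi>/2.\<close>
    have "filterlim (\<lambda>n. Im (Z n)) (at_right 0) sequentially"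
      using Y Z by (simp add: filterlim_at always_eventually less_imp_neq[symmetric])
    then have "filterlim (\<lambda>n. inverse (Im (Z n))) at_top sequentially"
      by (rule filterlim_compose[OF filterlim_inverse_at_top_right])
    then have "(\<lambda>n. arctan (1 / Im (Z n))) \<longlonglongrightarrow> pi / 2"
      unfolding inverse_eq_divide by (rule filterlim_compose[OF tendsto_arctan_at_top])
    then have l: "(\<lambda>n. complex_of_real (v (Re (Z n))) * (2 * \<i> * complex_of_real (arctan (1 / Im (Z n)))))
        \<longlonglongrightarrow> complex_of_real (v x) * (2 * \<i> * complex_of_real (pi / 2))"
      by (intro tendsto_mult tendsto_const tendsto_of_real v X)
    have "(\<lambda>n. cauchy (Z n)) \<longlonglongrightarrow> (\<integral>\<tau>. complex_of_real (g1 \<tau>) \<partial>lborel) + complex_of_real (v x) * (2 * \<i> * complex_of_real (pi / 2))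
       + (\<integral>\<tau>. complex_of_real (g2 \<tau>) \<partial>lborel) + (\<integral>t. complex_of_real (g3 t) \<partial>lborel)"
    proof (rule cauchy_tendsto_sequentially[OF Z _ _ _ _ _ _ l])
      show "AE \<tau> in lborel. (\<lambda>n. near (Z n) \<tau>) \<longlonglongrightarrow> complex_of_real (g1 \<tau>)"
        using AE_lborel_singleton[of 0] by eventually_elim (rule 1)
      show "AE \<tau> in lborel. (\<lambda>n. middle (Z n) \<tau>) \<longlonglongrightarrow> complex_of_real (g2 \<tau>)"
        using AE_lborel_singleton[of 0] AE_lborel_singleton[of "-2 * x"] AE_lborel_singleton[of "-2 * x / 3"]
        by eventually_elim (rule 2)
      show "AE t in lborel. (\<lambda>n. far (Z n) t) \<longlonglongrightarrow> complex_of_real (g3 t)"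
        using AE_lborel_singleton[of "- x"] AE_lborel_singleton[of "x / 3"]
          AE_lborel_singleton[of "x - 1"] AE_lborel_singleton[of "x + 1"]
        by eventually_elim (rule 3)
    qed measurable
    then show "(cauchy \<circ> Z) \<longlonglongrightarrow> complex_of_real r + \<i> * complex_of_real (pi * v x)"
      by (simp add: r_def o_def algebra_simps)
  qed
  then show ?thesis by (rule that)
qed

section \<open>The Cauchy integral at infinity\<close>

text \<open>When z is large in the half-plane, its real or its imaginary part is large. In the first
  case v is small and \<phi> bounded; in the second v is bounded and \<phi> small.\<close>

lemma tendsto_zero_at_infinity_times:
  fixes \<phi> :: "complex \<Rightarrow> complex"
  assumes \<phi>: "\<And>z. Im z > 0 \<Longrightarrow> cmod (\<phi> z) \<le> M" "\<And>z. Im z > 0 \<Longrightarrow> cmod (\<phi> z) \<le> M / Im z"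
  shows "((\<lambda>z. complex_of_real (v (Re z + \<sigma>)) * \<phi> z) \<longlongrightarrow> 0) (inf at_infinity (principal upper_half))"
proof (rule tendstoI)
  fix e :: real assume e: "e > 0"
  have M: "M \<ge> 0" using order_trans[OF norm_ge_zero \<phi>(1)[of \<i>]] by simp
  have "e / (M + 1) > 0" using e M by simp
  from tendstoD[OF lim0 this] obtain b where b: "\<And>s. \<bar>s\<bar> \<ge> b \<Longrightarrow> \<bar>v s\<bar> < e / (M + 1)"
    unfolding eventually_at_infinity by auto
  show "\<forall>\<^sub>F z in inf at_infinity (principal upper_half). dist (complex_of_real (v (Re z + \<sigma>)) * \<phi> z) 0 < e"
    unfolding eventually_inf_principal eventually_at_infinity
  \<comment> \<open>If \<bar>Re z + \<sigma>\<bar> < b, the remaining summand is a lower bound for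
    Im z; the added 1 makes B M / Im z < e strict.\<close>
  proof (intro exI[of _ "\<bar>b\<bar> + \<bar>\<sigma>\<bar> + (B * M + 1) / e"] allI impI)
    fix z assume z: "\<bar>b\<bar> + \<bar>\<sigma>\<bar> + (B * M + 1) / e \<le> cmod z" "z \<in> upper_half"
    have y: "Im z > 0" using z by (simp add: upper_half_def)
    have n: "dist (complex_of_real (v (Re z + \<sigma>)) * \<phi> z) 0 = \<bar>v (Re z + \<sigma>)\<bar> * cmod (\<phi> z)"
      by (simp add: norm_mult)
    show "dist (complex_of_real (v (Re z + \<sigma>)) * \<phi> z) 0 < e"
    proof (cases "\<bar>Re z + \<sigma>\<bar> \<ge> b")
      case True
      have "\<bar>v (Re z + \<sigma>)\<bar> * cmod (\<phi> z) \<le> e / (M + 1) * M"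
        using b[OF True] \<phi>(1)[OF y] M e by (intro mult_mono) auto
      also have "\<dots> < e" using e M by (simp add: field_simps)
      finally show ?thesis unfolding n .
    next
      case False
      have "cmod z \<le> \<bar>Re z\<bar> + \<bar>Im z\<bar>" by (rule cmod_le)
      then have "(B * M + 1) / e \<le> Im z" using False z(1) y by linarith
      then have *: "B * M < e * Im z" using e by (simp add: divide_le_eq mult.commute)
      have "\<bar>v (Re z + \<sigma>)\<bar> * cmod (\<phi> z) \<le> B * (M / Im z)"
        using bound[of "Re z + \<sigma>"] \<phi>(2)[OF y] M y bound_nonneg by (intro mult_mono) auto
      also have "\<dots> < e" using * y by (simp add: divide_less_eq)
      finally show ?thesis unfolding n .
    qed
  qed
qed

lemma cauchy_tendsto_at_infinity: "(cauchy \<longlongrightarrow> 0) (inf at_infinity (principal upper_half))"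
proof (rule tendsto_at_infinity_within_sequentially)
  let ?F = "inf at_infinity (principal upper_half)"
  fix Z :: "nat \<Rightarrow> complex"
  assume Z: "\<And>n. Z n \<in> upper_half" and "filterlim Z at_infinity sequentially"
  then have lim: "filterlim Z ?F sequentially"
    by (simp add: filterlim_inf filterlim_principal)
  have shifted: "((\<lambda>z. complex_of_real (v (Re z + \<sigma>)) * (1 / (complex_of_real \<tau> - \<i> * complex_of_real (Im z)))) \<longlongrightarrow> 0) ?F"
    if "\<tau> \<noteq> 0" for \<sigma> \<tau>
  proof (rule tendsto_zero_at_infinity_times)
    fix z :: complex assume y: "Im z > 0"
    let ?d = "cmod (complex_of_real \<tau> - \<i> * complex_of_real (Im z))"
    have "\<bar>\<tau>\<bar> \<le> ?d" "\<bar>Im z\<bar> \<le> ?d" by (rule shifted_denominator_ge)+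
    then have "1 / ?d \<le> 1 / \<bar>\<tau>\<bar>" "1 / ?d \<le> 1 / Im z"
      using that y by (simp_all add: frac_le)
    \<comment> \<open>One constant has to serve both bounds on the kernel, the uniform one and the
      decaying one.\<close>
    moreover have "1 / Im z \<le> max (1 / \<bar>\<tau>\<bar>) 1 / Im z" using y by (intro divide_right_mono) auto
    ultimately show "cmod (1 / (complex_of_real \<tau> - \<i> * complex_of_real (Im z))) \<le> max (1 / \<bar>\<tau>\<bar>) 1"
      "cmod (1 / (complex_of_real \<tau> - \<i> * complex_of_real (Im z))) \<le> max (1 / \<bar>\<tau>\<bar>) 1 / Im z"
      by (auto simp: norm_divide)
  qed
  have 1: "((\<lambda>z. near z \<tau>) \<longlongrightarrow> 0) ?F" if "\<tau> \<noteq> 0" for \<tau>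
  proof (cases "\<bar>\<tau>\<bar> \<le> 1")
    case True
    then have "near z \<tau> = complex_of_real (v (Re z + \<tau>)) * (1 / (complex_of_real \<tau> - \<i> * complex_of_real (Im z)))
        - complex_of_real (v (Re z + 0)) * (1 / (complex_of_real \<tau> - \<i> * complex_of_real (Im z)))" for z
      by (simp add: near_def diff_divide_distrib)
    then show ?thesis
      using tendsto_diff[OF shifted[OF that, of \<tau>] shifted[OF that, of 0]] by simp
  qed (simp add: near_def)
  have 2: "((\<lambda>z. middle z \<tau>) \<longlongrightarrow> 0) ?F" if "\<tau> \<noteq> 0" for \<tau>
    by (rule Lim_null_comparison[OF always_eventually tendsto_norm_zero[OF shifted[OF that, of \<tau>]]])
       (auto simp: middle_def)
  have 3: "((\<lambda>z. far z t) \<longlongrightarrow> 0) ?F" for t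
  proof (rule Lim_null_comparison[OF always_eventually])
    show "\<forall>z. cmod (far z t) \<le> cmod (complex_of_real (v t) * inverse (complex_of_real t - z))"
      unfolding far_def divide_inverse by simp
    have "filterlim (\<lambda>z. complex_of_real t - z) at_infinity at_infinity"
      unfolding filterlim_at_infinity[of 0, OF order_refl] eventually_at_infinity
    proof (intro allI impI)
      fix R :: real
      show "\<exists>b. \<forall>z. b \<le> cmod z \<longrightarrow> R \<le> cmod (complex_of_real t - z)"
      proof (intro exI[of _ "R + \<bar>t\<bar>"] allI impI)
        fix z assume "R + \<bar>t\<bar> \<le> cmod z"
        then show "R \<le> cmod (complex_of_real t - z)"
          using norm_triangle_ineq2[of z "complex_of_real t"] norm_minus_commute[of z "complex_of_real t"]
          by simp
      qed
    qed
    then have "((\<lambda>z. inverse (complex_of_real t - z)) \<longlongrightarrow> 0) at_infinity"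
      by (rule filterlim_compose[OF tendsto_inverse_0])
    then have "((\<lambda>z. inverse (complex_of_real t - z)) \<longlongrightarrow> 0) ?F"
      by (rule tendsto_mono[OF inf_le1])
    from tendsto_norm_zero[OF tendsto_mult_right_zero[OF this]]
    show "((\<lambda>z. cmod (complex_of_real (v t) * inverse (complex_of_real t - z))) \<longlongrightarrow> 0) ?F" .
  qed
  have l: "((\<lambda>z. complex_of_real (v (Re z)) * (2 * \<i> * complex_of_real (arctan (1 / Im z)))) \<longlongrightarrow> 0) ?F"
  proof -
    have "((\<lambda>z. complex_of_real (v (Re z + 0)) * (2 * \<i> * complex_of_real (arctan (1 / Im z)))) \<longlongrightarrow> 0) ?F"
    proof (rule tendsto_zero_at_infinity_times)
      fix z :: complex assume y: "Im z > 0"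
      \<comment> \<open>The constant 4 is twice the crude bound \<pi>/2 < 2; decay in Im z comes
        from arctan s \<le> s.\<close>
      have "arctan (1 / Im z) < 2" "arctan (1 / Im z) \<le> 1 / Im z" "arctan (1 / Im z) > 0"
        using y arctan_ubound[of "1 / Im z"] pi_less_4 arctan_le_self[of "1 / Im z"] by auto
      moreover have "2 * (1 / Im z) \<le> 4 / Im z" using y by (simp add: divide_right_mono)
      ultimately show "cmod (2 * \<i> * complex_of_real (arctan (1 / Im z))) \<le> 4"
        "cmod (2 * \<i> * complex_of_real (arctan (1 / Im z))) \<le> 4 / Im z"
        by (auto simp: norm_mult)
    qed
    then show ?thesis by simp
  qed
  have "(\<lambda>n. cauchy (Z n)) \<longlonglongrightarrow> integral\<^sup>L lborel (\<lambda>_::real. 0) + 0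
      + integral\<^sup>L lborel (\<lambda>_::real. 0) + integral\<^sup>L lborel (\<lambda>_::real. 0)"
  proof (rule cauchy_tendsto_sequentially)
    show "AE \<tau> in lborel. (\<lambda>n. near (Z n) \<tau>) \<longlonglongrightarrow> 0"
      using AE_lborel_singleton[of 0] by eventually_elim (rule filterlim_compose[OF 1 lim])
    show "AE \<tau> in lborel. (\<lambda>n. middle (Z n) \<tau>) \<longlonglongrightarrow> 0"
      using AE_lborel_singleton[of 0] by eventually_elim (rule filterlim_compose[OF 2 lim])
    show "AE t in lborel. (\<lambda>n. far (Z n) t) \<longlonglongrightarrow> 0"
      by (intro AE_I2 filterlim_compose[OF 3 lim])
    show "Im (Z n) > 0" for n using Z by (simp add: upper_half_def)
  qed (use filterlim_compose[OF l lim] in auto)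
  then show "(\<lambda>n. cauchy (Z n)) \<longlonglongrightarrow> 0" by simp
qed

end

section \<open>The Schwartz integral\<close>

text \<open>The Schwartz integral is defined by symmetric truncation of gauge integrals; dominated
  convergence identifies the limit with the Lebesgue integral used for
  \<open>cauchy\<close>.\<close>

lemma integral_symmetric_tendsto:
  fixes f :: "real \<Rightarrow> complex"
  assumes f: "integrable lborel f"
  shows "((\<lambda>N. integral {- N..N} f) \<longlongrightarrow> integral\<^sup>L lborel f) at_top"
proof -
  have "((\<lambda>N. \<integral>t. indicator {- N..N} t *\<^sub>R f t \<partial>lborel) \<longlongrightarrow> integral\<^sup>L lborel f) at_top"
  proof (rule integral_dominated_convergence_at_top)
    show "AE t in lborel. ((\<lambda>N. indicator {- N..N} t *\<^sub>R f t) \<longlongrightarrow> f t) at_top"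
    proof (rule AE_I2)
      fix t :: real
      show "((\<lambda>N. indicator {- N..N} t *\<^sub>R f t) \<longlongrightarrow> f t) at_top"
        by (rule tendsto_eventually, rule eventually_mono[OF eventually_ge_at_top[of "\<bar>t\<bar>"]])
           (auto simp: indicator_def)
    qed
    show "\<forall>\<^sub>F N in at_top. AE t in lborel. norm (indicator {- N..N} t *\<^sub>R f t) \<le> norm (f t)"
      by (auto simp: indicator_def)
  qed (use f in auto)
  moreover have "(\<integral>t. indicator {- N..N} t *\<^sub>R f t \<partial>lborel) = integral {- N..N} f" for N :: real
    using set_borel_integral_eq_integral(2)[of "{- N..N}" f] f
    by (simp add: set_integrable_def set_lebesgue_integral_def integrable_mult_indicator)
  ultimately show ?thesis by simp
qed

lemma has_integral_pair:
  fixes f :: "real \<Rightarrow> complex" and g :: "real \<Rightarrow> complex"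
  assumes f: "(f has_integral a) S" and g: "(g has_integral b) S"
  shows "((\<lambda>t. (f t, g t)) has_integral (a, b)) S"
proof -
  have "((\<lambda>x. (x, 0)) \<circ> f has_integral (a, 0 :: complex)) S"
    by (rule has_integral_linear[OF f]) (intro bounded_linear_Pair bounded_linear_ident bounded_linear_zero)
  moreover have "((\<lambda>x. (0, x)) \<circ> g has_integral (0 :: complex, b)) S"
    by (rule has_integral_linear[OF g]) (intro bounded_linear_Pair bounded_linear_ident bounded_linear_zero)
  ultimately have "((\<lambda>t. (f t, 0) + (0, g t)) has_integral (a, 0) + (0, b)) S"
    unfolding o_def by (rule has_integral_add)
  then show ?thesis by simp
qed

text \<open>With \<open>h = t e1 - \<zeta>\<close> one has \<open>e1 + t \<zeta> = (1 + t\<^sup>2) e1 - t h\<close>.\<close>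

lemma schwartz_integrand_eq:
  fixes t :: real and w z :: complex
  assumes z: "Im z > 0"
  defines "w \<equiv> complex_of_real t - z"
  shows "schwartz_integrand u (plane_embed z) t =
    u t *\<^sub>R (1 / w - \<i> * Im z / w\<^sup>2 - complex_of_real (t / (t\<^sup>2 + 1)), Im z / w\<^sup>2)"
proof -
  define h where "h = t *\<^sub>R e1 - plane_embed z"
  define q where "q = binv h"
  have w: "Complex (t - Re z) (- Im z) = w" by (simp add: w_def complex_eq_iff)
  have q: "q = (1 / w - \<i> * Im z / w\<^sup>2, Im z / w\<^sup>2)"
    unfolding q_def h_def plane_embed_def binv_shift[OF z] w by simp
  have h: "h = plane_embed (complex_of_real t - z)"
    by (simp add: h_def plane_embed_eq e1_def scaleR_conv_of_real)
  have "complex_of_real t - z \<noteq> 0" using z by (auto simp: complex_eq_iff)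
  then have "h \<noteq> 0" unfolding h by (metis plane_embed_0 plane_embed_eq_iff)
  then have hq: "h *\<^sub>B q = e1"
    unfolding q_def by (intro biharm_plane_invertible) (auto simp: h biharm_plane_eq)
  have p: "t\<^sup>2 + 1 \<noteq> 0" by (metis add_pos_nonneg add.commute less_irrefl zero_le_power2 zero_less_one)
  have "e1 + t *\<^sub>R plane_embed z = (1 + t\<^sup>2) *\<^sub>R e1 - t *\<^sub>R h"
    by (simp add: h_def algebra_simps power2_eq_square)
  then have "(e1 + t *\<^sub>R plane_embed z) *\<^sub>B q = (1 + t\<^sup>2) *\<^sub>R (e1 *\<^sub>B q) - t *\<^sub>R (h *\<^sub>B q)"
    by (simp only:) (simp add: bmult_def scaleR_conv_of_real prod_eq_iff algebra_simps)
  then have "schwartz_integrand u (plane_embed z) t = (u t / (t\<^sup>2 + 1)) *\<^sub>R ((1 + t\<^sup>2) *\<^sub>R q - t *\<^sub>R e1)"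
    unfolding schwartz_integrand_def h_def[symmetric] q_def[symmetric] by (simp add: hq)
  also have "\<dots> = u t *\<^sub>R (q - (t / (t\<^sup>2 + 1)) *\<^sub>R e1)"
    using p by (simp add: scaleR_right_diff_distrib add.commute)
  finally show ?thesis unfolding q by (simp add: e1_def scaleR_conv_of_real)
qed

text \<open>After division by \<pi> \<i> this says that the Schwartz integral of the constant 1 is
  \<open>e1\<close>.\<close>

lemma schwartz_kernel_constant:
  assumes z: "Im z > 0"
  shows "((\<lambda>N::real. integral {- N..N} (\<lambda>t. 1 / (complex_of_real t - z) - complex_of_real (t / (t\<^sup>2 + 1)))) \<longlongrightarrow> \<i> * complex_of_real pi) at_top"
    and "((\<lambda>N::real. integral {- N..N} (\<lambda>t. 1 / (complex_of_real t - z)\<^sup>2)) \<longlongrightarrow> 0) at_top"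
proof -
  define x y where "x = Re z" and "y = Im z"
  have y: "y > 0" using z by (simp add: y_def)
  have nz: "complex_of_real t - z \<noteq> 0" for t using z by (auto simp: complex_eq_iff)
  have p: "(t - x)\<^sup>2 + y\<^sup>2 > 0" "t\<^sup>2 + 1 > 0" for t using y by (simp_all add: add_nonneg_pos)
  \<comment> \<open>Up to a constant, a branch of log (t - z) minus half of the logarithm of t^2 +
    1. Between -N and N the latter cancels by evenness, the former leaves the logarithm of a
    quotient tending to 1, and arctan contributes \<pi>.\<close>
  define \<Phi> where "\<Phi> t = complex_of_real (ln ((t - x)\<^sup>2 + y\<^sup>2) / 2 - ln (t\<^sup>2 + 1) / 2)
      + \<i> * complex_of_real (arctan ((t - x) / y))" for t
  have eq: "1 / (complex_of_real t - z) - complex_of_real (t / (t\<^sup>2 + 1)) =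
      complex_of_real ((t - x) / ((t - x)\<^sup>2 + y\<^sup>2) - t / (t\<^sup>2 + 1)) + \<i> * complex_of_real (y / ((t - x)\<^sup>2 + y\<^sup>2))" for t
  proof -
    have "1 / (complex_of_real t - z) = cnj (complex_of_real t - z) / complex_of_real ((t - x)\<^sup>2 + y\<^sup>2)"
      using complex_div_cnj[of 1 "complex_of_real t - z"] by (simp add: cmod_power2 x_def y_def)
    then show ?thesis by (simp add: complex_eq_iff x_def y_def)
  qed
  have ln_half: "((\<lambda>t. ln (f t) / 2) has_real_derivative g t / f t) (at t within S)"
    if "(f has_real_derivative 2 * g t) (at t within S)" "f t > 0" for f g :: "real \<Rightarrow> real" and t S
  proof -
    have "((\<lambda>t. ln (f t)) has_real_derivative 2 * g t / f t) (at t within S)"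
      using that by (auto intro!: derivative_eq_intros)
    moreover have "2 * g t / f t / 2 = g t / f t" by simp
    ultimately show ?thesis using DERIV_cdivide[of "\<lambda>t. ln (f t)" "2 * g t / f t" t S 2] by simp
  qed
  have d1: "((\<lambda>t. (t - x)\<^sup>2 + y\<^sup>2) has_real_derivative 2 * (t - x)) (at t within S)" for t S
    by (auto intro!: derivative_eq_intros)
  have d2: "((\<lambda>t. t\<^sup>2 + 1) has_real_derivative 2 * t) (at t within S)" for t :: real and S
    by (auto intro!: derivative_eq_intros)
  have d3: "((\<lambda>t. arctan ((t - x) / y)) has_real_derivative y / ((t - x)\<^sup>2 + y\<^sup>2)) (at t within S)" for t S
    using p(1)[of t] y by (auto intro!: derivative_eq_intros simp: divide_simps power2_eq_square)
  have "(\<Phi> has_vector_derivative 1 / (complex_of_real t - z) - complex_of_real (t / (t\<^sup>2 + 1))) (at t within S)" for t S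
    unfolding \<Phi>_def eq
    by (intro has_vector_derivative_add has_vector_derivative_mult_right has_vector_derivative_of_real
        DERIV_diff ln_half d1 d2 d3 p)
  then have "((\<lambda>t. 1 / (complex_of_real t - z) - complex_of_real (t / (t\<^sup>2 + 1))) has_integral \<Phi> N - \<Phi> (- N)) {- N..N}"
    if "N \<ge> 0" for N using that by (intro fundamental_theorem_of_calculus) auto
  then have 1: "integral {- N..N} (\<lambda>t. 1 / (complex_of_real t - z) - complex_of_real (t / (t\<^sup>2 + 1))) = \<Phi> N - \<Phi> (- N)"
    if "N \<ge> 0" for N using that by (intro integral_unique)
  have \<Phi>_diff: "\<Phi> N - \<Phi> (- N) = complex_of_real (ln (((N - x)\<^sup>2 + y\<^sup>2) / ((- N - x)\<^sup>2 + y\<^sup>2)) / 2)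
      + \<i> * complex_of_real (arctan ((N - x) / y) - arctan ((- N - x) / y))" for N
    using p(1)[of N] p(1)[of "- N"] y by (simp add: \<Phi>_def ln_div diff_divide_distrib algebra_simps)
  have q: "((\<lambda>N. ((N - x)\<^sup>2 + y\<^sup>2) / ((- N - x)\<^sup>2 + y\<^sup>2)) \<longlongrightarrow> 1) at_top"
    by real_asymp
  have a1: "((\<lambda>N. arctan ((N - x) / y)) \<longlongrightarrow> pi / 2) at_top"
    using y by real_asymp
  have a2: "((\<lambda>N. arctan ((- N - x) / y)) \<longlongrightarrow> - (pi / 2)) at_top"
    using y by real_asymp
  have "((\<lambda>N. \<Phi> N - \<Phi> (- N)) \<longlongrightarrow> complex_of_real (ln 1 / 2) + \<i> * complex_of_real (pi / 2 - - (pi / 2))) at_top"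
    unfolding \<Phi>_diff
    by (intro tendsto_add tendsto_mult tendsto_of_real tendsto_const tendsto_divide tendsto_ln q tendsto_diff a1 a2) auto
  then have "((\<lambda>N. \<Phi> N - \<Phi> (- N)) \<longlongrightarrow> \<i> * complex_of_real pi) at_top" by simp
  then show "((\<lambda>N::real. integral {- N..N} (\<lambda>t. 1 / (complex_of_real t - z) - complex_of_real (t / (t\<^sup>2 + 1)))) \<longlongrightarrow> \<i> * complex_of_real pi) at_top"
    by (rule Lim_transform_eventually, intro eventually_mono[OF eventually_ge_at_top[of 0]]) (simp only: 1)
  define \<Psi> where "\<Psi> t = - inverse (complex_of_real t - z)" for t
  have "(\<Psi> has_vector_derivative 1 / (complex_of_real t - z)\<^sup>2) (at t within S)" for t S
  proof -
    have "((\<lambda>w. - inverse (w - z)) has_field_derivative 1 / (complex_of_real t - z)\<^sup>2) (at (complex_of_real t))"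
      using nz[of t] by (auto intro!: derivative_eq_intros simp: power2_eq_square divide_inverse)
    from has_vector_derivative_real_field[OF this] show ?thesis unfolding \<Psi>_def .
  qed
  then have "((\<lambda>t. 1 / (complex_of_real t - z)\<^sup>2) has_integral \<Psi> N - \<Psi> (- N)) {- N..N}"
    if "N \<ge> 0" for N using that by (intro fundamental_theorem_of_calculus) auto
  then have 2: "integral {- N..N} (\<lambda>t. 1 / (complex_of_real t - z)\<^sup>2) = \<Psi> N - \<Psi> (- N)"
    if "N \<ge> 0" for N using that by (intro integral_unique)
  have "filterlim (\<lambda>N. complex_of_real N + - z) at_infinity at_top"
    by (rule tendsto_add_filterlim_at_infinity'[OF filterlim_of_real_at_infinity tendsto_const])
  then have "filterlim (\<lambda>N. complex_of_real N - z) at_infinity at_top" by simp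
  then have i1: "((\<lambda>N. inverse (complex_of_real N - z)) \<longlongrightarrow> 0) at_top"
    by (rule filterlim_compose[OF tendsto_inverse_0])
  have "filterlim (\<lambda>N. complex_of_real N + z) at_infinity at_top"
    by (rule tendsto_add_filterlim_at_infinity'[OF filterlim_of_real_at_infinity tendsto_const])
  then have "((\<lambda>N. inverse (complex_of_real N + z)) \<longlongrightarrow> 0) at_top"
    by (rule filterlim_compose[OF tendsto_inverse_0])
  from tendsto_diff[OF tendsto_minus[OF i1] this]
  have "((\<lambda>N. - inverse (complex_of_real N - z) - inverse (complex_of_real N + z)) \<longlongrightarrow> 0) at_top"
    by simp
  moreover have "\<Psi> N - \<Psi> (- N) = - inverse (complex_of_real N - z) - inverse (complex_of_real N + z)" for N
  proof -
    have "complex_of_real (- N) - z = - (complex_of_real N + z)" by simp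
    then show ?thesis unfolding \<Psi>_def by (simp only: inverse_minus_eq) simp
  qed
  ultimately have "((\<lambda>N. \<Psi> N - \<Psi> (- N)) \<longlongrightarrow> 0) at_top" by (simp only:)
  then show "((\<lambda>N::real. integral {- N..N} (\<lambda>t. 1 / (complex_of_real t - z)\<^sup>2)) \<longlongrightarrow> 0) at_top"
    by (rule Lim_transform_eventually, intro eventually_mono[OF eventually_ge_at_top[of 0]]) (simp only: 2)
qed

context dini_density
begin

section \<open>From the Cauchy integral to the Schwartz integral\<close>

text \<open>The share of the term t / (t^2 + 1) of the Schwartz kernel. Being real, after division
  by \<pi> \<i> it shifts imaginary parts only.\<close>

definition normalization :: real where
  "normalization = (\<integral>t. v t * (t / (t\<^sup>2 + 1)) \<partial>lborel)"

lemma integrable_normalization: "integrable lborel (\<lambda>t. v t * (t / (t\<^sup>2 + 1)))"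
proof (rule Bochner_Integration.integrable_bound[OF integrable_envelope])
  show "AE t in lborel. norm (v t * (t / (t\<^sup>2 + 1))) \<le> norm (envelope t)"
  proof (rule AE_I2)
    fix t :: real
    have p: "t\<^sup>2 + 1 > 0" by (simp add: add_nonneg_pos)
    have "max 1 \<bar>t\<bar> * \<bar>t\<bar> \<le> t\<^sup>2 + 1"
    proof (cases "\<bar>t\<bar> \<le> 1")
      case True
      then show ?thesis by (simp add: max_def add_increasing)
    next
      case False
      then show ?thesis by (simp add: max_def power2_eq_square)
    qed
    then have q: "max 1 \<bar>t\<bar> * (\<bar>t\<bar> / (t\<^sup>2 + 1)) \<le> 1" using p by (simp add: divide_le_eq)
    have "norm (v t * (t / (t\<^sup>2 + 1))) = \<bar>v t\<bar> * (\<bar>t\<bar> / (t\<^sup>2 + 1))"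
      using p by (simp add: abs_mult)
    also have "\<dots> \<le> max 1 \<bar>t\<bar> * envelope t * (\<bar>t\<bar> / (t\<^sup>2 + 1))"
      using p by (intro mult_right_mono v_le_envelope) auto
    also have "\<dots> = (max 1 \<bar>t\<bar> * (\<bar>t\<bar> / (t\<^sup>2 + 1))) * envelope t" by simp
    also have "\<dots> \<le> 1 * envelope t"
      by (intro mult_right_mono q envelope_nonneg)
    finally show "norm (v t * (t / (t\<^sup>2 + 1))) \<le> norm (envelope t)" by simp
  qed
qed simp

definition schwartz :: "real \<Rightarrow> complex \<Rightarrow> complex" where
  "schwartz c z = (cauchy z - complex_of_real normalization) / (complex_of_real pi * \<i>) + complex_of_real c"

lemma schwartz_holomorphic: "schwartz c holomorphic_on upper_half"
  unfolding schwartz_def[abs_def] by (intro holomorphic_intros cauchy_holomorphic) auto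

lemma deriv_schwartz:
  assumes "Im z > 0"
  shows "deriv (schwartz c) z = cauchy_deriv z / (complex_of_real pi * \<i>)"
  unfolding schwartz_def[abs_def]
  by (intro DERIV_imp_deriv) (auto intro!: derivative_eq_intros cauchy_has_derivative[OF assms])

text \<open>The derivative enters because 1 / (t - z)^2 is the z-derivative of 1 / (t - z). The
  constant c contributes c itself to the first kernel and nothing to the second, in agreement with a
  derivative that does not see c.\<close>

lemma schwartz_integral_eq:
  assumes z: "Im z > 0"
  shows "schwartz_integral (\<lambda>t. v t + c) (plane_embed z) =
    (schwartz c z - \<i> * complex_of_real (Im z) * deriv (schwartz c) z,
     complex_of_real (Im z) * deriv (schwartz c) z)"
proof -
  define y where "y = complex_of_real (Im z)"
  have nz: "complex_of_real t - z \<noteq> 0" for t using z by (auto simp: complex_eq_iff)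
  have p: "t\<^sup>2 + 1 \<noteq> 0" for t :: real
    by (metis add_pos_nonneg add.commute less_irrefl zero_le_power2 zero_less_one)
  then have p': "(complex_of_real t)\<^sup>2 + 1 \<noteq> 0" for t
    by (metis of_real_1 of_real_add of_real_eq_0_iff of_real_power)
  let ?f1 = "\<lambda>t. complex_of_real (v t) / (complex_of_real t - z)"
  let ?f2 = "\<lambda>t. complex_of_real (v t) / (complex_of_real t - z)\<^sup>2"
  let ?f3 = "\<lambda>t. complex_of_real (v t * (t / (t\<^sup>2 + 1)))"
  let ?g1 = "\<lambda>t. 1 / (complex_of_real t - z) - complex_of_real (t / (t\<^sup>2 + 1))"
  let ?g2 = "\<lambda>t. 1 / (complex_of_real t - z)\<^sup>2"
  have contv: "continuous_on S v" for S using cont by (rule continuous_on_subset) simp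
  have I: "?f1 integrable_on {- N..N}" "?f2 integrable_on {- N..N}" "?f3 integrable_on {- N..N}"
      "?g1 integrable_on {- N..N}" "?g2 integrable_on {- N..N}" for N
    using nz p p' by (auto intro!: integrable_continuous_interval continuous_intros contv)
  note H = I[THEN integrable_integral]
  have "(schwartz_integrand (\<lambda>t. v t + c) (plane_embed z) has_integral
      (integral {- N..N} ?f1 - \<i> * y * integral {- N..N} ?f2 - integral {- N..N} ?f3
         + complex_of_real c * (integral {- N..N} ?g1 - \<i> * y * integral {- N..N} ?g2),
       y * integral {- N..N} ?f2 + complex_of_real c * (y * integral {- N..N} ?g2))) {- N..N}" for N
  proof (rule has_integral_eq)
    show "((\<lambda>t. (?f1 t - \<i> * y * ?f2 t - ?f3 t + complex_of_real c * (?g1 t - \<i> * y * ?g2 t),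
          y * ?f2 t + complex_of_real c * (y * ?g2 t))) has_integral
      (integral {- N..N} ?f1 - \<i> * y * integral {- N..N} ?f2 - integral {- N..N} ?f3
         + complex_of_real c * (integral {- N..N} ?g1 - \<i> * y * integral {- N..N} ?g2),
       y * integral {- N..N} ?f2 + complex_of_real c * (y * integral {- N..N} ?g2))) {- N..N}"
      by (intro has_integral_pair has_integral_add has_integral_diff has_integral_mult_right H)
    show "(?f1 t - \<i> * y * ?f2 t - ?f3 t + complex_of_real c * (?g1 t - \<i> * y * ?g2 t),
          y * ?f2 t + complex_of_real c * (y * ?g2 t)) =
        schwartz_integrand (\<lambda>t. v t + c) (plane_embed z) t" for t
      unfolding schwartz_integrand_eq[OF z]
      by (simp add: y_def scaleR_conv_of_real divide_inverse algebra_simps)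
  qed
  then have eq: "integral {- N..N} (schwartz_integrand (\<lambda>t. v t + c) (plane_embed z)) =
      (integral {- N..N} ?f1 - \<i> * y * integral {- N..N} ?f2 - integral {- N..N} ?f3
         + complex_of_real c * (integral {- N..N} ?g1 - \<i> * y * integral {- N..N} ?g2),
       y * integral {- N..N} ?f2 + complex_of_real c * (y * integral {- N..N} ?g2))" for N
    by (rule integral_unique)
  have n: "integral\<^sup>L lborel ?f3 = complex_of_real normalization"
    unfolding normalization_def by (rule integral_complex_of_real)
  have f3: "integrable lborel ?f3"
    using integrable_normalization by (simp only: complex_of_real_integrable_eq)
  have L1: "((\<lambda>N. integral {- N..N} ?f1) \<longlongrightarrow> cauchy z) at_top"
    unfolding cauchy_def by (rule integral_symmetric_tendsto[OF integrable_kernel[OF z]])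
  have L2: "((\<lambda>N. integral {- N..N} ?f2) \<longlongrightarrow> cauchy_deriv z) at_top"
    unfolding cauchy_deriv_def by (rule integral_symmetric_tendsto[OF integrable_kernel2[OF z]])
  have L3: "((\<lambda>N. integral {- N..N} ?f3) \<longlongrightarrow> complex_of_real normalization) at_top"
    using integral_symmetric_tendsto[OF f3] unfolding n .
  have "((\<lambda>N. integral {- N..N} (schwartz_integrand (\<lambda>t. v t + c) (plane_embed z))) \<longlongrightarrow>
      (cauchy z - \<i> * y * cauchy_deriv z - complex_of_real normalization
         + complex_of_real c * (\<i> * complex_of_real pi - \<i> * y * 0),
       y * cauchy_deriv z + complex_of_real c * (y * 0))) at_top"
    unfolding eq
    by (intro tendsto_Pair tendsto_add tendsto_diff tendsto_mult tendsto_const L1 L2 L3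
        schwartz_kernel_constant[OF z])
  then have "Lim at_top (\<lambda>N. integral {- N..N} (schwartz_integrand (\<lambda>t. v t + c) (plane_embed z))) =
      (cauchy z - \<i> * y * cauchy_deriv z - complex_of_real normalization
         + complex_of_real c * (\<i> * complex_of_real pi - \<i> * y * 0),
       y * cauchy_deriv z + complex_of_real c * (y * 0))"
    by (intro tendsto_Lim) auto
  then show ?thesis
    unfolding schwartz_integral_def deriv_schwartz[OF z]
    by (simp add: schwartz_def cscale_def y_def field_simps)
qed

text \<open>Division by \<pi> \<i> turns the jump \<pi> \<i> v(x) into v(x) and makes the real
  numbers r and \<open>normalization\<close> purely imaginary.\<close>

lemma schwartz_tendsto_boundary:
  obtains l where "Re l = v x + c" "(schwartz c \<longlongrightarrow> l) (at (complex_of_real x) within upper_half)"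
proof -
  obtain r where r: "(cauchy \<longlongrightarrow> complex_of_real r + \<i> * complex_of_real (pi * v x)) (at (complex_of_real x) within upper_half)"
    by (rule cauchy_tendsto_boundary)
  show ?thesis
  proof (rule that)
    show "(schwartz c \<longlongrightarrow> (complex_of_real r + \<i> * complex_of_real (pi * v x) - complex_of_real normalization)
        / (complex_of_real pi * \<i>) + complex_of_real c) (at (complex_of_real x) within upper_half)"
      unfolding schwartz_def[abs_def] by (intro tendsto_intros r) auto
    have "(complex_of_real r + \<i> * complex_of_real (pi * v x) - complex_of_real normalization)
        / (complex_of_real pi * \<i>) = complex_of_real (v x) + \<i> * complex_of_real ((normalization - r) / pi)"
      by (simp add: field_simps)
    then show "Re ((complex_of_real r + \<i> * complex_of_real (pi * v x) - complex_of_real normalization)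
        / (complex_of_real pi * \<i>) + complex_of_real c) = v x + c" by simp
  qed
qed

lemma schwartz_tendsto_at_infinity:
  "(schwartz c \<longlongrightarrow> (0 - complex_of_real normalization) / (complex_of_real pi * \<i>) + complex_of_real c)
    (inf at_infinity (principal upper_half))"
  unfolding schwartz_def[abs_def] by (intro tendsto_intros cauchy_tendsto_at_infinity) auto

end

lemma schwartz_integral_dini:
  assumes "continuous_on UNIV u" "\<exists>c. (u \<longlongrightarrow> c) at_infinity" "dini_conditions u"
  obtains s L where "s holomorphic_on upper_half"
    "\<And>z. z \<in> upper_half \<Longrightarrow> schwartz_integral u (plane_embed z) =
      (s z - \<i> * complex_of_real (Im z) * deriv s z, complex_of_real (Im z) * deriv s z)"
    "\<And>x. \<exists>l. Re l = u x \<and> (s \<longlongrightarrow> l) (at (complex_of_real x) within upper_half)"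
    "(s \<longlongrightarrow> L) (inf at_infinity (principal upper_half))"
proof -
  obtain c where c: "(u \<longlongrightarrow> c) at_infinity" using assms(2) by blast
  obtain k1 k2 B where "dini_density (\<lambda>t. u t - c) k1 k2 B"
    using dini_density_exists[OF assms(1) c assms(3)] by blast
  then interpret dini_density "\<lambda>t. u t - c" k1 k2 B .
  show thesis
  proof (rule that)
    show "schwartz c holomorphic_on upper_half" by (rule schwartz_holomorphic)
    show "schwartz_integral u (plane_embed z) =
      (schwartz c z - \<i> * complex_of_real (Im z) * deriv (schwartz c) z,
       complex_of_real (Im z) * deriv (schwartz c) z)" if "z \<in> upper_half" for z
      using schwartz_integral_eq[of z c] that by (simp add: upper_half_def)
    show "\<exists>l. Re l = u x \<and> (schwartz c \<longlongrightarrow> l) (at (complex_of_real x) within upper_half)" for x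
      using schwartz_tendsto_boundary[of x c] by auto
  qed (rule schwartz_tendsto_at_infinity)
qed

section \<open>The general solution\<close>

lemma at_within_upper_half_neq_bot:
  assumes "Im z \<ge> 0"
  shows "at z within upper_half \<noteq> bot"
proof
  assume "at z within upper_half = bot"
  then have "\<forall>\<^sub>F w in at z within upper_half. False" by simp
  then obtain d where d: "d > 0" and *: "\<And>w. w \<in> upper_half \<Longrightarrow> w \<noteq> z \<Longrightarrow> dist w z \<ge> d"
    unfolding eventually_at by (auto simp: not_less)
  have "d \<le> dist (z + \<i> * complex_of_real (d / 2)) z"
    using d assms by (intro *) (auto simp: upper_half_def)
  then show False using d by (simp add: dist_norm norm_mult)
qed

lemma extend_by_limits_half_plane: "z \<in> upper_half \<Longrightarrow> extend_by_limits F (plane_embed z) = F (plane_embed z)"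
  by (simp add: extend_by_limits_def)

lemma extend_by_limits_boundary:
  assumes "((\<lambda>z. F (plane_embed z)) \<longlongrightarrow> l) (at (complex_of_real x) within upper_half)"
  shows "extend_by_limits F (plane_embed (complex_of_real x)) = l"
proof -
  have "(F \<longlongrightarrow> l) (at (plane_embed (complex_of_real x)) within half_plane)"
    using assms unfolding half_plane_eq at_within_plane_embed filterlim_filtermap .
  moreover have "at (plane_embed (complex_of_real x)) within half_plane \<noteq> bot"
    unfolding half_plane_eq at_within_plane_embed filtermap_bot_iff
    by (rule at_within_upper_half_neq_bot) simp
  ultimately show ?thesis by (simp add: extend_by_limits_def upper_half_def tendsto_Lim)
qed

text \<open>At any nearby point of the closed half-plane the extension is a limit of interior
  values, all within e/2 of the value at z; the closed inequality survives the limit.\<close>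

lemma continuous_on_extend_by_limits:
  assumes cont: "continuous_on upper_half (\<lambda>z. F (plane_embed z))"
    and lim: "\<And>x. ((\<lambda>z. F (plane_embed z)) \<longlongrightarrow> l x) (at (complex_of_real x) within upper_half)"
  shows "continuous_on closed_half_plane (extend_by_limits F)"
  unfolding closed_half_plane_eq continuous_on_plane_embed
  unfolding continuous_on_iff
proof (intro ballI allI impI)
  let ?g = "\<lambda>z. extend_by_limits F (plane_embed z)"
  have limg: "((\<lambda>z. F (plane_embed z)) \<longlongrightarrow> ?g z) (at z within upper_half)" if "Im z \<ge> 0" for z
  proof (cases "z \<in> upper_half")
    case True
    then show ?thesis using cont by (simp add: continuous_on_def extend_by_limits_half_plane)
  next
    case False
    with that have "z = complex_of_real (Re z)" by (simp add: upper_half_def complex_eq_iff)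
    then show ?thesis using lim[of "Re z"] extend_by_limits_boundary[OF lim, of "Re z"] by metis
  qed
  fix z :: complex and e :: real assume "z \<in> {z. Im z \<ge> 0}" and e: "e > 0"
  then have "Im z \<ge> 0" by simp
  from tendstoD[OF limg[OF this], of "e / 2"] e obtain d where d: "d > 0" and
    *: "\<And>w. w \<in> upper_half \<Longrightarrow> w \<noteq> z \<Longrightarrow> dist w z < d \<Longrightarrow> dist (F (plane_embed w)) (?g z) < e / 2"
    unfolding eventually_at by auto
  have "dist (?g z') (?g z) < e" if z': "Im z' \<ge> 0" "dist z' z < d" "z' \<noteq> z" for z'
  proof -
    have "dist (?g z') (?g z) \<le> e / 2"
    proof (rule tendsto_upperbound)
      show "((\<lambda>w. dist (F (plane_embed w)) (?g z)) \<longlongrightarrow> dist (?g z') (?g z)) (at z' within upper_half)"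
        by (intro tendsto_dist limg z' tendsto_const)
      have 1: "\<forall>\<^sub>F w in at z' within upper_half. w \<in> upper_half"
        by (simp add: eventually_at_filter)
      \<comment> \<open>The estimate on F excludes w = z, so the ball is punctured; it is still a
        neighbourhood of z' since z' differs from z.\<close>
      have "open (ball z d - {z})" "z' \<in> ball z d - {z}"
        using z' by (auto simp: dist_commute)
      then have "\<forall>\<^sub>F w in at z' within upper_half. w \<in> ball z d - {z}"
        by (rule topological_tendstoD[OF tendsto_ident_at])
      with 1 show "\<forall>\<^sub>F w in at z' within upper_half. dist (F (plane_embed w)) (?g z) \<le> e / 2"
        by eventually_elim (rule less_imp_le, rule *, auto simp: dist_commute)
      show "at z' within upper_half \<noteq> bot" using z'(1) by (rule at_within_upper_half_neq_bot)
    qed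
    then show ?thesis using e by simp
  qed
  then have "dist (?g z') (?g z) < e" if "Im z' \<ge> 0" "dist z' z < d" for z'
    using that e by (cases "z' = z") auto
  then show "\<exists>d>0. \<forall>z'\<in>{z. Im z \<ge> 0}. dist z' z < d \<longrightarrow> dist (?g z') (?g z) < e"
    using d by auto
qed

lemma general_13_solution_solves:
  assumes "continuous_on UNIV u1" and "continuous_on UNIV u3"
    and "\<exists>c. (u1 \<longlongrightarrow> c) at_infinity" and "\<exists>c. (u3 \<longlongrightarrow> c) at_infinity"
    and "dini_conditions u1" and "dini_conditions u3"
  shows "solves_13_problem u1 u3 (extend_by_limits (general_13_solution u1 u3 a1 a2))"
proof -
  let ?F = "general_13_solution u1 u3 a1 a2"
  let ?E = "extend_by_limits ?F"
  let ?y = "\<lambda>z. complex_of_real (Im z)"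
  obtain s1 L1 where s1: "s1 holomorphic_on upper_half"
    "\<And>z. z \<in> upper_half \<Longrightarrow> schwartz_integral u1 (plane_embed z) = (s1 z - \<i> * ?y z * deriv s1 z, ?y z * deriv s1 z)"
    "\<And>x. \<exists>l. Re l = u1 x \<and> (s1 \<longlongrightarrow> l) (at (complex_of_real x) within upper_half)"
    "(s1 \<longlongrightarrow> L1) (inf at_infinity (principal upper_half))"
    using schwartz_integral_dini[OF assms(1,3,5)] by blast
  obtain s3 L3 where s3: "s3 holomorphic_on upper_half"
    "\<And>z. z \<in> upper_half \<Longrightarrow> schwartz_integral u3 (plane_embed z) = (s3 z - \<i> * ?y z * deriv s3 z, ?y z * deriv s3 z)"
    "\<And>x. \<exists>l. Re l = u3 x \<and> (s3 \<longlongrightarrow> l) (at (complex_of_real x) within upper_half)"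
    "(s3 \<longlongrightarrow> L3) (inf at_infinity (principal upper_half))"
    using schwartz_integral_dini[OF assms(2,4,6)] by blast
  obtain l1 where l1: "\<And>x. Re (l1 x) = u1 x" "\<And>x. (s1 \<longlongrightarrow> l1 x) (at (complex_of_real x) within upper_half)"
    using s1(3) by metis
  obtain l3 where l3: "\<And>x. Re (l3 x) = u3 x" "\<And>x. (s3 \<longlongrightarrow> l3 x) (at (complex_of_real x) within upper_half)"
    using s3(3) by metis
  \<comment> \<open>Multiplication by \<open>e2\<close> sends (p, q) to (q, p + 2 \<i> q), which
    gives the terms with \<open>s3\<close>.\<close>
  define f where "f z = (s1 z - \<i> * (?y z * deriv s1 z) + ?y z * deriv s3 z + \<i> * a1,
      ?y z * deriv s1 z + s3 z + \<i> * (?y z * deriv s3 z) + \<i> * a2)" for z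
  have F: "?F (plane_embed z) = f z" if "z \<in> upper_half" for z
    unfolding general_13_solution_def s1(2)[OF that] s3(2)[OF that] f_def
    by (simp add: bmult_def e1_def e2_def cscale_def scaleR_conv_of_real algebra_simps)
  have lim_f: "(f \<longlongrightarrow> (l - \<i> * 0 + 0 + \<i> * a1, 0 + m + \<i> * 0 + \<i> * a2)) G"
    if "(s1 \<longlongrightarrow> l) G" "((\<lambda>z. ?y z * deriv s1 z) \<longlongrightarrow> 0) G"
      "(s3 \<longlongrightarrow> m) G" "((\<lambda>z. ?y z * deriv s3 z) \<longlongrightarrow> 0) G" for l m G
    unfolding f_def[abs_def] by (intro tendsto_Pair tendsto_add tendsto_diff tendsto_mult tendsto_const that)
  have f_bdry: "(f \<longlongrightarrow> (l1 x + \<i> * a1, l3 x + \<i> * a2)) (at (complex_of_real x) within upper_half)" for x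
    using lim_f[OF l1(2) tendsto_Im_deriv[OF s1(1) l1(2)] l3(2) tendsto_Im_deriv[OF s3(1) l3(2)]] by simp
  have F_bdry: "((\<lambda>z. ?F (plane_embed z)) \<longlongrightarrow> (l1 x + \<i> * a1, l3 x + \<i> * a2)) (at (complex_of_real x) within upper_half)" for x
    by (rule Lim_transform_eventually[OF f_bdry]) (auto simp: eventually_at_filter F)
  have f_inf: "(f \<longlongrightarrow> (L1 + \<i> * a1, L3 + \<i> * a2)) (inf at_infinity (principal upper_half))"
    using lim_f[OF s1(4) tendsto_Im_deriv_at_infinity[OF s1(1,4)] s3(4) tendsto_Im_deriv_at_infinity[OF s3(1,4)]]
    by simp
  have "((\<lambda>z. ?E (plane_embed z)) \<longlongrightarrow> (L1 + \<i> * a1, L3 + \<i> * a2)) (inf at_infinity (principal upper_half))"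
    by (rule Lim_transform_eventually[OF f_inf])
       (auto simp: eventually_inf_principal extend_by_limits_half_plane F)
  then have E_inf: "(?E \<longlongrightarrow> (L1 + \<i> * a1, L3 + \<i> * a2)) (inf at_infinity (principal half_plane))"
    unfolding half_plane_eq at_infinity_plane_embed filterlim_filtermap .
  have "continuous_on upper_half f"
    unfolding f_def
    by (intro continuous_intros holomorphic_on_imp_continuous_on holomorphic_deriv s1(1) s3(1) open_upper_half)
  then have "continuous_on upper_half (\<lambda>z. ?F (plane_embed z))"
    by (rule continuous_on_eq) (simp add: F)
  then have cont: "continuous_on closed_half_plane ?E"
    using F_bdry by (rule continuous_on_extend_by_limits)
  have mono: "monogenic_on ?E half_plane"
  proof (rule monogenic_onI)
    \<comment> \<open>A is the \<open>spectral\<close> image of f, in which all terms with Im z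
      cancel; G is what remains of the second component after subtracting y A'.\<close>
    show hA: "(\<lambda>z. s1 z + \<i> * s3 z + (\<i> * a1 - a2)) holomorphic_on upper_half"
      and "(\<lambda>z. s3 z + \<i> * a2) holomorphic_on upper_half"
      by (intro holomorphic_intros s1(1) s3(1))+
    fix z assume z: "z \<in> upper_half"
    have "((\<lambda>z. s1 z + \<i> * s3 z + (\<i> * a1 - a2)) has_field_derivative deriv s1 z + \<i> * deriv s3 z + 0) (at z)"
      by (intro derivative_intros DERIV_cmult holomorphic_derivI[OF s1(1) open_upper_half z]
          holomorphic_derivI[OF s3(1) open_upper_half z])
    then have d: "deriv (\<lambda>z. s1 z + \<i> * s3 z + (\<i> * a1 - a2)) z = deriv s1 z + \<i> * deriv s3 z"
      by (simp add: DERIV_imp_deriv)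
    show "spectral (?E (plane_embed z)) = s1 z + \<i> * s3 z + (\<i> * a1 - a2)"
      by (simp add: extend_by_limits_half_plane F z f_def spectral_def algebra_simps)
    show "snd (?E (plane_embed z)) = Im z * deriv (\<lambda>z. s1 z + \<i> * s3 z + (\<i> * a1 - a2)) z + (s3 z + \<i> * a2)"
      unfolding d by (simp add: extend_by_limits_half_plane F z f_def algebra_simps)
  qed
  have "?E (plane_pt \<xi> 0) = (l1 \<xi> + \<i> * a1, l3 \<xi> + \<i> * a2)" for \<xi>
    using extend_by_limits_boundary[OF F_bdry, of \<xi>] by (simp add: plane_pt_eq_embed complex_of_real_def)
  then have "U1 ?E \<xi> 0 = u1 \<xi> \<and> U3 ?E \<xi> 0 = u3 \<xi>" for \<xi>
    by (simp add: U1_def U3_def l1(1) l3(1))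
  with cont mono E_inf show ?thesis unfolding solves_13_problem_def by blast
qed

theorem theorem1:
  fixes u1 u3 :: "real \<Rightarrow> real"
  assumes "continuous_on UNIV u1" and "continuous_on UNIV u3"
    and "\<exists>c. (u1 \<longlongrightarrow> c) at_infinity" and "\<exists>c. (u3 \<longlongrightarrow> c) at_infinity"
    and "dini_conditions u1" and "dini_conditions u3"
  shows "(\<forall>a1 a2. solves_13_problem u1 u3 (extend_by_limits (general_13_solution u1 u3 a1 a2))) \<and>
    (\<forall>\<Phi>. solves_13_problem u1 u3 \<Phi> \<longrightarrow>
      (\<exists>a1 a2. \<forall>\<zeta>\<in>half_plane. \<Phi> \<zeta> = general_13_solution u1 u3 a1 a2 \<zeta>))"
proof (intro conjI allI impI)
  show "solves_13_problem u1 u3 (extend_by_limits (general_13_solution u1 u3 a1 a2))" for a1 a2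
    using assms by (rule general_13_solution_solves)
  fix \<Phi> assume \<Phi>: "solves_13_problem u1 u3 \<Phi>"
  \<comment> \<open>The formula is affine in a1 and a2, so the difference from this particular
    solution gives the two constants directly.\<close>
  let ?S = "general_13_solution u1 u3 0 0"
  obtain a1 a2 where a: "\<And>\<zeta>. \<zeta> \<in> half_plane \<Longrightarrow>
      \<Phi> \<zeta> - extend_by_limits ?S \<zeta> = a1 *\<^sub>R (\<i> *\<^sub>C e1) + a2 *\<^sub>R (\<i> *\<^sub>C e2)"
    using homogeneous_13_problem[OF solves_13_problem_diff[OF \<Phi> general_13_solution_solves[OF assms]]] by blast
  have "\<Phi> \<zeta> = general_13_solution u1 u3 a1 a2 \<zeta>" if "\<zeta> \<in> half_plane" for \<zeta>
  proof -
    have "\<Phi> \<zeta> = ?S \<zeta> + (a1 *\<^sub>R (\<i> *\<^sub>C e1) + a2 *\<^sub>R (\<i> *\<^sub>C e2))"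
      using a[OF that] that by (simp add: extend_by_limits_def algebra_simps)
    then show ?thesis by (simp add: general_13_solution_def)
  qed
  then show "\<exists>a1 a2. \<forall>\<zeta>\<in>half_plane. \<Phi> \<zeta> = general_13_solution u1 u3 a1 a2 \<zeta>" by blast
qed

end
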